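(* Let $N$ be a $6$-dimensional manifold endowed with an $SU(3)$-structure $(\omega,\psi)$, $\psi = \psi_+ + i\psi_-$, let $\alpha = dt$ on $S^1$, and let $H$ be a $3$-form (not necessarily closed) on $N\times S^1$. The structure form $$\rho = \omega + \psi_+\wedge\alpha - \tfrac16\omega^3,$$ with companion $\hat\rho = \alpha - \psi_- - \tfrac12\omega^2\wedge\alpha$, defines a strongly integrable generalized $G_2$-structure on $N\times S^1$ with respect to $H$, i.e. $$d\rho + H\wedge\rho = 0,\qquad d\hat\rho + H\wedge\hat\rho = 0,$$ if and only if $(N,\omega,\psi)$ is in the class $\mathcal{W}_2^+$ and $H = \pi_2\wedge\alpha$, where $\pi_2$ is the $\mathcal{W}_2^+$-component of the intrinsic torsion.
   Context: An $SU(3)$-structure on a $6$-manifold $N$ is given by a Riemannian metric $g$, an orthogonal almost complex structure $J$ with fundamental form $\omega(X,Y) = g(JX,Y)$, and a complex volume form $\psi = \psi_+ + i\psi_-$ of unit norm; locally there is an orthonormal coframe $(e^1,\dots,e^6)$ with $\omega = e^{12}+e^{34}+e^{56}$ and $\psi = (e^1+ie^2)\wedge(e^3+ie^4)\wedge(e^5+ie^6)$, where $e^{ij} = e^i\wedge e^j$. The $SU(3)$-structure is in the class $\mathcal{W}_2^+$ if $$d\omega = 0,\qquad d\psi_- = 0,\qquad d\psi_+ = -\pi_2\wedge\omega,$$ where the $2$-form $\pi_2$ on $N$ (the only possibly non-zero component of the intrinsic torsion) takes values in $\{\gamma\in\Lambda^2 : J\gamma = \gamma,\ \gamma\wedge\omega^2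 = 0\}$, with $(J\gamma)(X,Y) = \gamma(JX,JY)$. On $N\times S^1$, forms on the factors are identified with their pull-backs; $t$ is the standard coordinate on $S^1$ and $N\times S^1$ carries the product metric $g + dt\otimes dt$. Forms of mixed degree are added formally, so an equation between them means equality in each degree. *)

theory Defs
  imports "HOL-Analysis.Analysis"
begin

section \<open>Smooth manifolds\<close>

primrec Ck_on :: "nat \<Rightarrow> ('a::real_normed_vector \<Rightarrow> 'b::real_normed_vector) \<Rightarrow> 'a set \<Rightarrow> bool" where
  "Ck_on 0 f S \<longleftrightarrow> continuous_on S f"
| "Ck_on (Suc k) f S \<longleftrightarrow> (\<forall>x\<in>S. f differentiable (at x)) \<and>
     (\<forall>v. Ck_on k (\<lambda>x. frechet_derivative f (at x) v) S)"

text \<open>Only used for open sets in Euclidean spaces.\<close>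

definition smooth_on :: "('a::real_normed_vector \<Rightarrow> 'b::real_normed_vector) \<Rightarrow> 'a set \<Rightarrow> bool" where
  "smooth_on f S \<longleftrightarrow> (\<forall>k. Ck_on k f S)"

text \<open>A manifold modelled on the Euclidean space \<open>'e\<close> is a topological space with an atlas
  indexed by the set \<open>charts\<close>; the chart \<open>i\<close> is \<open>cmap i\<close>, defined on \<open>cdom i\<close>. The atlas
  is not required to be maximal.\<close>

record ('i, 'a, 'e) manifold =
  points :: "'a topology"
  charts :: "'i set"
  cdom :: "'i \<Rightarrow> 'a set"
  cmap :: "'i \<Rightarrow> 'a \<Rightarrow> 'e"

definition cran :: "('i, 'a, 'e) manifold \<Rightarrow> 'i \<Rightarrow> 'e set" where
  "cran M i = cmap M i ` cdom M i"

definition overlap :: "('i, 'a, 'e) manifold \<Rightarrow> 'i \<Rightarrow> 'i \<Rightarrow> 'e set" where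
  "overlap M i j = cmap M i ` (cdom M i \<inter> cdom M j)"

definition trans_map :: "('i, 'a, 'e) manifold \<Rightarrow> 'i \<Rightarrow> 'i \<Rightarrow> 'e \<Rightarrow> 'e" where
  "trans_map M i j = cmap M j \<circ> inv_into (cdom M i) (cmap M i)"

definition trans_deriv ::
    "('i, 'a, 'e::euclidean_space) manifold \<Rightarrow> 'i \<Rightarrow> 'i \<Rightarrow> 'e \<Rightarrow> 'e \<Rightarrow> 'e" where
  "trans_deriv M i j x = frechet_derivative (trans_map M i j) (at x)"

definition smooth_manifold :: "('i, 'a, 'e::euclidean_space) manifold \<Rightarrow> bool" where
  "smooth_manifold M \<longleftrightarrow>
     Hausdorff_space (points M) \<and> second_countable (points M) \<and>
     (\<Union>i\<in>charts M. cdom M i) = topspace (points M) \<and>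
     (\<forall>i\<in>charts M. openin (points M) (cdom M i) \<and> open (cran M i) \<and>
        homeomorphic_map (subtopology (points M) (cdom M i)) (top_of_set (cran M i)) (cmap M i)) \<and>
     (\<forall>i\<in>charts M. \<forall>j\<in>charts M. smooth_on (trans_map M i j) (overlap M i j))"

definition prod_manifold ::
    "('i, 'a, 'e) manifold \<Rightarrow> ('j, 'b, 'f) manifold \<Rightarrow> ('i \<times> 'j, 'a \<times> 'b, 'e \<times> 'f) manifold" where
  "prod_manifold M M' =
     \<lparr> points = prod_topology (points M) (points M'),
       charts = charts M \<times> charts M',
       cdom = (\<lambda>c. cdom M (fst c) \<times> cdom M' (snd c)),
       cmap = (\<lambda>c p. (cmap M (fst c) (fst p), cmap M' (snd c) (snd p))) \<rparr>"

text \<open>The chart \<open>a\<close> of the circle is the branch of the angular coordinate \<open>t\<close> with values in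
  \<open>(a, a + 2 pi)\<close>.\<close>

definition circle :: "(real, complex, real) manifold" where
  "circle =
     \<lparr> points = top_of_set (sphere 0 1),
       charts = UNIV,
       cdom = (\<lambda>a. sphere 0 1 - {cis a}),
       cmap = (\<lambda>a. inv_into {a<..<a + 2 * pi} cis) \<rparr>"


section \<open>Differential forms\<close>

text \<open>A form on a vector space is a function on lists of vectors. Its part of degree \<open>k\<close> is its
  restriction to the lists of length \<open>k\<close>, so forms of mixed degree are covered, and equality of
  two of them is equality in each degree.\<close>

definition alternating_form :: "nat \<Rightarrow> ('v::real_vector list \<Rightarrow> 'b::real_vector) \<Rightarrow> bool" where
  "alternating_form k f \<longleftrightarrow>
     (\<forall>vs. length vs \<noteq> k \<longrightarrow> f vs = 0) \<and>
     (\<forall>vs i. length vs = k \<and> i < k \<longrightarrow> linear (\<lambda>v. f (vs[i := v]))) \<and>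
     (\<forall>vs i j. length vs = k \<and> i < j \<and> j < k \<and> vs ! i = vs ! j \<longrightarrow> f vs = 0)"

text \<open>The shuffle formula for the wedge product: \<open>I\<close> is the set of positions of the arguments
  given to the first factor, and the sign is that of the shuffle, by counting inversions. With this
  normalisation \<open>(a \<and> b)(v, w) = a(v) b(w) - a(w) b(v)\<close> for \<open>1\<close>-forms.\<close>

definition wedge_alt :: "('v list \<Rightarrow> 'b) \<Rightarrow> ('v list \<Rightarrow> 'b) \<Rightarrow> 'v list \<Rightarrow> 'b::comm_ring_1" where
  "wedge_alt f g vs =
     (\<Sum>I\<in>Pow {..<length vs}.
        (- 1) ^ card {(i, j). i \<in> I \<and> j \<in> {..<length vs} - I \<and> j < i}
          * f (nths vs I) * g (nths vs (- I)))"

text \<open>A field of forms is given by its expressions in the charts: \<open>F i x\<close> is the form in the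
  chart \<open>i\<close> at the point with coordinates \<open>x\<close>, tangent vectors being identified with their
  coordinate vectors. Only the values for \<open>i \<in> charts M\<close> and \<open>x \<in> cran M i\<close> are meaningful.\<close>

type_synonym ('i, 'e, 'b) form_field = "'i \<Rightarrow> 'e \<Rightarrow> 'e list \<Rightarrow> 'b"

definition diff_form ::
    "('i, 'a, 'e::euclidean_space) manifold \<Rightarrow> nat \<Rightarrow>
     ('i, 'e, 'b::real_normed_vector) form_field \<Rightarrow> bool" where
  "diff_form M k F \<longleftrightarrow>
     (\<forall>i\<in>charts M. (\<forall>x\<in>cran M i. alternating_form k (F i x)) \<and>
        (\<forall>vs. smooth_on (\<lambda>x. F i x vs) (cran M i))) \<and>
     (\<forall>i\<in>charts M. \<forall>j\<in>charts M. \<forall>x\<in>overlap M i j. \<forall>vs.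
        F i x vs = F j (trans_map M i j x) (map (trans_deriv M i j x) vs))"

definition form_eq ::
    "('i, 'a, 'e) manifold \<Rightarrow> ('i, 'e, 'b) form_field \<Rightarrow> ('i, 'e, 'b) form_field \<Rightarrow> bool" where
  "form_eq M F G \<longleftrightarrow> (\<forall>i\<in>charts M. \<forall>x\<in>cran M i. \<forall>vs. F i x vs = G i x vs)"

definition zero_form :: "('i, 'e, 'b::zero) form_field" where
  "zero_form = (\<lambda>i x vs. 0)"

definition form_plus ::
    "('i, 'e, 'b::plus) form_field \<Rightarrow> ('i, 'e, 'b) form_field \<Rightarrow> ('i, 'e, 'b) form_field"
    (infixl \<open>\<^bold>+\<close> 65) where
  "F \<^bold>+ G = (\<lambda>i x vs. F i x vs + G i x vs)"

definition form_scale ::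
    "'b::times \<Rightarrow> ('i, 'e, 'b) form_field \<Rightarrow> ('i, 'e, 'b) form_field" (infixr \<open>\<^bold>*\<close> 68) where
  "c \<^bold>* F = (\<lambda>i x vs. c * F i x vs)"

definition wedge ::
    "('i, 'e, 'b::comm_ring_1) form_field \<Rightarrow> ('i, 'e, 'b) form_field \<Rightarrow> ('i, 'e, 'b) form_field"
    (infixr \<open>\<^bold>\<and>\<close> 70) where
  "F \<^bold>\<and> G = (\<lambda>i x. wedge_alt (F i x) (G i x))"

text \<open>Exterior derivative: in coordinates, \<open>(dF)(v\<^sub>0,\<dots>,v\<^sub>k)\<close> is the alternating sum of the
  derivatives of \<open>F(v\<^sub>0,\<dots>,v\<^sub>k)\<close>, with \<open>v\<^sub>i\<close> omitted, in the direction \<open>v\<^sub>i\<close>.\<close>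

definition ext_d ::
    "('i, 'e::euclidean_space, 'b::real_normed_algebra_1) form_field \<Rightarrow> ('i, 'e, 'b) form_field" where
  "ext_d F = (\<lambda>i x vs. \<Sum>k<length vs.
     (- 1) ^ k * frechet_derivative (\<lambda>y. F i y (take k vs @ drop (Suc k) vs)) (at x) (vs ! k))"

definition pull_fst :: "('i, 'e, 'b) form_field \<Rightarrow> ('i \<times> 'j, 'e \<times> 'f, 'b) form_field" where
  "pull_fst F = (\<lambda>c z vs. F (fst c) (fst z) (map fst vs))"

definition pull_snd :: "('j, 'f, 'b) form_field \<Rightarrow> ('i \<times> 'j, 'e \<times> 'f, 'b) form_field" where
  "pull_snd F = (\<lambda>c z vs. F (snd c) (snd z) (map snd vs))"

text \<open>The form \<open>dt\<close> on the circle: every chart of \<^const>\<open>circle\<close> is a branch of \<open>t\<close>.\<close>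

definition dt :: "(real, real, real) form_field" where
  "dt = (\<lambda>a t vs. if length vs = 1 then vs ! 0 else 0)"


section \<open>SU(3)-structures\<close>

definition riemannian_metric ::
    "('i, 'a, 'e::euclidean_space) manifold \<Rightarrow> ('i \<Rightarrow> 'e \<Rightarrow> 'e \<Rightarrow> 'e \<Rightarrow> real) \<Rightarrow> bool" where
  "riemannian_metric M g \<longleftrightarrow>
     (\<forall>i\<in>charts M.
        (\<forall>x\<in>cran M i. bilinear (g i x) \<and> (\<forall>v w. g i x v w = g i x w v) \<and>
           (\<forall>v. v \<noteq> 0 \<longrightarrow> g i x v v > 0)) \<and>
        (\<forall>v w. smooth_on (\<lambda>x. g i x v w) (cran M i))) \<and>
     (\<forall>i\<in>charts M. \<forall>j\<in>charts M. \<forall>x\<in>overlap M i j. \<forall>v w.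
        g i x v w = g j (trans_map M i j x) (trans_deriv M i j x v) (trans_deriv M i j x w))"

definition almost_complex ::
    "('i, 'a, 'e::euclidean_space) manifold \<Rightarrow> ('i \<Rightarrow> 'e \<Rightarrow> 'e \<Rightarrow> 'e) \<Rightarrow> bool" where
  "almost_complex M J \<longleftrightarrow>
     (\<forall>i\<in>charts M.
        (\<forall>x\<in>cran M i. linear (J i x) \<and> (\<forall>v. J i x (J i x v) = - v)) \<and>
        (\<forall>v. smooth_on (\<lambda>x. J i x v) (cran M i))) \<and>
     (\<forall>i\<in>charts M. \<forall>j\<in>charts M. \<forall>x\<in>overlap M i j. \<forall>v.
        trans_deriv M i j x (J i x v) = J j (trans_map M i j x) (trans_deriv M i j x v))"

definition orthogonal_acs ::
    "('i, 'a, 'e) manifold \<Rightarrow> ('i \<Rightarrow> 'e \<Rightarrow> 'e \<Rightarrow> 'e \<Rightarrow> real) \<Rightarrow> ('i \<Rightarrow> 'e \<Rightarrow> 'e \<Rightarrow> 'e) \<Rightarrow> bool" where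
  "orthogonal_acs M g J \<longleftrightarrow>
     (\<forall>i\<in>charts M. \<forall>x\<in>cran M i. \<forall>v w. g i x (J i x v) (J i x w) = g i x v w)"

definition fundamental_form ::
    "('i \<Rightarrow> 'e \<Rightarrow> 'e \<Rightarrow> 'e \<Rightarrow> real) \<Rightarrow> ('i \<Rightarrow> 'e \<Rightarrow> 'e \<Rightarrow> 'e) \<Rightarrow> ('i, 'e, real) form_field" where
  "fundamental_form g J = (\<lambda>i x vs. if length vs = 2 then g i x (J i x (vs ! 0)) (vs ! 1) else 0)"

text \<open>A smooth local coframe \<open>e 1, \<dots>, e 6\<close> on an open set \<open>V\<close> of coordinates in the chart \<open>i\<close>, in
  which the structure has its standard form. In dimension six the identity for \<open>g\<close> says that
  the \<open>e k\<close> form an orthonormal coframe; the identity for \<open>\<psi>\<close> fixes the normalisation of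
  its norm.\<close>

definition adapted_coframe ::
    "('i \<Rightarrow> 'e \<Rightarrow> 'e \<Rightarrow> 'e \<Rightarrow> real) \<Rightarrow> ('i, 'e, real) form_field \<Rightarrow> ('i, 'e, complex) form_field \<Rightarrow>
     'i \<Rightarrow> 'e::euclidean_space set \<Rightarrow> (nat \<Rightarrow> 'e \<Rightarrow> 'e list \<Rightarrow> real) \<Rightarrow> bool" where
  "adapted_coframe g \<omega> \<psi> i V e \<longleftrightarrow>
     (\<forall>k\<in>{1..6}. (\<forall>y\<in>V. alternating_form 1 (e k y)) \<and> (\<forall>vs. smooth_on (\<lambda>y. e k y vs) V)) \<and>
     (\<forall>y\<in>V.
        (\<forall>v w. g i y v w = (\<Sum>k=1..6. e k y [v] * e k y [w])) \<and>
        (\<forall>vs. \<omega> i y vs = wedge_alt (e 1 y) (e 2 y) vs + wedge_alt (e 3 y) (e 4 y) vs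
                 + wedge_alt (e 5 y) (e 6 y) vs) \<and>
        \<psi> i y = wedge_alt (\<lambda>vs. Complex (e 1 y vs) (e 2 y vs))
                  (wedge_alt (\<lambda>vs. Complex (e 3 y vs) (e 4 y vs))
                             (\<lambda>vs. Complex (e 5 y vs) (e 6 y vs))))"

definition su3_structure ::
    "('i, 'a, real^6) manifold \<Rightarrow> ('i \<Rightarrow> real^6 \<Rightarrow> real^6 \<Rightarrow> real^6 \<Rightarrow> real) \<Rightarrow>
     ('i \<Rightarrow> real^6 \<Rightarrow> real^6 \<Rightarrow> real^6) \<Rightarrow> ('i, real^6, real) form_field \<Rightarrow>
     ('i, real^6, complex) form_field \<Rightarrow> bool" where
  "su3_structure N g J \<omega> \<psi> \<longleftrightarrow>
     riemannian_metric N g \<and> almost_complex N J \<and> orthogonal_acs N g J \<and>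
     form_eq N \<omega> (fundamental_form g J) \<and>
     diff_form N 3 \<psi> \<and>
     (\<forall>i\<in>charts N. \<forall>x\<in>cran N i. \<forall>u v w. \<psi> i x [J i x u, v, w] = \<i> * \<psi> i x [u, v, w]) \<and>
     (\<forall>i\<in>charts N. \<forall>x\<in>cran N i. \<exists>V e. open V \<and> x \<in> V \<and> V \<subseteq> cran N i \<and>
        adapted_coframe g \<omega> \<psi> i V e)"

definition re_form :: "('i, 'e, complex) form_field \<Rightarrow> ('i, 'e, real) form_field" where
  "re_form \<psi> = (\<lambda>i x vs. Re (\<psi> i x vs))"

definition im_form :: "('i, 'e, complex) form_field \<Rightarrow> ('i, 'e, real) form_field" where
  "im_form \<psi> = (\<lambda>i x vs. Im (\<psi> i x vs))"

text \<open>The \<open>SU(3)\<close>-structure is in the class \<open>W\<^sub>2\<^sup>+\<close>, and \<open>\<pi>\<close> is the \<open>W\<^sub>2\<^sup>+\<close>-component of its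
  intrinsic torsion. The equation for \<open>d \<psi>\<^sub>+\<close> determines \<open>\<pi>\<close>, since \<open>\<gamma> \<mapsto> \<gamma> \<and> \<omega>\<close> is
  injective on \<open>2\<close>-forms in dimension six.\<close>

definition W2_plus ::
    "('i, 'a, real^6) manifold \<Rightarrow> ('i \<Rightarrow> real^6 \<Rightarrow> real^6 \<Rightarrow> real^6) \<Rightarrow>
     ('i, real^6, real) form_field \<Rightarrow> ('i, real^6, complex) form_field \<Rightarrow>
     ('i, real^6, real) form_field \<Rightarrow> bool" where
  "W2_plus N J \<omega> \<psi> \<pi> \<longleftrightarrow>
     diff_form N 2 \<pi> \<and>
     (\<forall>i\<in>charts N. \<forall>x\<in>cran N i. \<forall>v w. \<pi> i x [J i x v, J i x w] = \<pi> i x [v, w]) \<and>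
     form_eq N (\<pi> \<^bold>\<and> \<omega> \<^bold>\<and> \<omega>) zero_form \<and>
     form_eq N (ext_d \<omega>) zero_form \<and>
     form_eq N (ext_d (im_form \<psi>)) zero_form \<and>
     form_eq N (ext_d (re_form \<psi>)) (- 1 \<^bold>* (\<pi> \<^bold>\<and> \<omega>))"


section \<open>Generalized G2-structures on the product with a circle\<close>

definition rho :: "('i, 'e, real) form_field \<Rightarrow> ('i, 'e, complex) form_field \<Rightarrow>
    ('i \<times> real, 'e \<times> real, real) form_field" where
  "rho \<omega> \<psi> = pull_fst \<omega> \<^bold>+ (pull_fst (re_form \<psi>) \<^bold>\<and> pull_snd dt)
     \<^bold>+ (- 1 / 6) \<^bold>* (pull_fst \<omega> \<^bold>\<and> pull_fst \<omega> \<^bold>\<and> pull_fst \<omega>)"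

definition rho_hat :: "('i, 'e, real) form_field \<Rightarrow> ('i, 'e, complex) form_field \<Rightarrow>
    ('i \<times> real, 'e \<times> real, real) form_field" where
  "rho_hat \<omega> \<psi> = pull_snd dt \<^bold>+ (- 1) \<^bold>* pull_fst (im_form \<psi>)
     \<^bold>+ (- 1 / 2) \<^bold>* (pull_fst \<omega> \<^bold>\<and> pull_fst \<omega> \<^bold>\<and> pull_snd dt)"

definition strongly_integrable ::
    "('i, 'a, 'e::euclidean_space) manifold \<Rightarrow> ('i, 'e, real) form_field \<Rightarrow>
     ('i, 'e, real) form_field \<Rightarrow> ('i, 'e, real) form_field \<Rightarrow> bool" where
  "strongly_integrable M H \<rho> \<rho>' \<longleftrightarrow>
     form_eq M (ext_d \<rho> \<^bold>+ H \<^bold>\<and> \<rho>) zero_form \<and> form_eq M (ext_d \<rho>' \<^bold>+ H \<^bold>\<and> \<rho>') zero_form"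

end

theory Submission
  imports Defs
begin

text \<open>Contracting with the first vector gives \<open>\<iota>\<^sub>v (f \<and> g) = \<iota>\<^sub>v f \<and> g \<plusminus> f \<and> \<iota>\<^sub>v g\<close>, so associativity,
  graded commutativity and the Leibniz rule for the shuffle product follow by induction on the list of
  arguments, without using multilinearity.

  Comparing degrees, the part of degree 3 of \<open>d\<rho> + H \<and> \<rho> = 0\<close> is \<open>d\<omega> = 0\<close>, and the part of degree 4 of
  \<open>d\<rho>' + H \<and> \<rho>' = 0\<close>, where \<open>d\<psi>\<^sub>-\<close> has no \<open>dt\<close> component, gives \<open>d\<psi>\<^sub>- = 0\<close> and \<open>H \<and> dt = 0\<close>, hence
  \<open>H = \<pi> \<and> dt\<close>. In degrees 5 and 6 there remain \<open>d\<psi>\<^sub>+ = - \<pi> \<and> \<omega>\<close> and \<open>\<pi> \<and> \<psi>\<^sub>- = 0\<close>. As \<open>\<gamma> \<mapsto> \<gamma> \<and> \<omega>\<close>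
  is injective on 2-forms, \<open>\<pi>\<close> does not depend on \<open>t\<close>. For a 2-form, \<open>\<pi> \<and> \<psi>\<^sub>- = 0\<close> is equivalent to
  \<open>J \<pi> = \<pi>\<close>, and \<open>\<pi> \<and> \<omega>\<^sup>2 = - d(\<psi>\<^sub>+ \<and> \<omega>) = 0\<close> since \<open>\<psi>\<^sub>+ \<and> \<omega> = 0\<close>.\<close>

section \<open>The shuffle product\<close>

text \<open>The parity involution of the graded algebra, which is the sign that a contraction picks
  up when it passes the first factor. Reading the sign off the length of the list covers forms of
  mixed degree.\<close>

definition flip :: "('v list \<Rightarrow> 'b::comm_ring_1) \<Rightarrow> 'v list \<Rightarrow> 'b" where
  "flip f = (\<lambda>vs. (- 1) ^ length vs * f vs)"

definition homogeneous :: "nat \<Rightarrow> ('v list \<Rightarrow> 'b::zero) \<Rightarrow> bool" where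
  "homogeneous p f \<longleftrightarrow> (\<forall>vs. length vs \<noteq> p \<longrightarrow> f vs = 0)"

lemma homogeneousD: "homogeneous p f \<Longrightarrow> length vs \<noteq> p \<Longrightarrow> f vs = 0"
  by (simp add: homogeneous_def)

lemma wedge_alt_Nil [simp]: "wedge_alt f g [] = f [] * g []"
  by (simp add: wedge_alt_def)

text \<open>Position 0 goes either to \<open>f\<close> or to \<open>g\<close>. In the first case it
  takes part in no inversion; in the second it makes one inversion with each position given to
  \<open>f\<close>, and these signs amount to \<open>flip f\<close>. This is the antiderivation rule
  for the contraction with \<open>v\<close>.\<close>

lemma wedge_alt_Cons:
  "wedge_alt f g (v # vs) =
     wedge_alt (\<lambda>us. f (v # us)) g vs + wedge_alt (flip f) (\<lambda>us. g (v # us)) vs"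
proof -
  define n where "n = length vs"
  define invs where "invs m I = {(i, j). i \<in> I \<and> j \<in> {..<m} - I \<and> j < i}" for m and I :: "nat set"
  define h where "h m ws I = (- 1) ^ card (invs m I) * f (nths ws I) * g (nths ws (- I))"
    for m ws I
  have fin: "finite (invs m I)" if "I \<subseteq> {..<m}" for m I
    by (rule finite_subset[of _ "{..<m} \<times> {..<m}"]) (use that in \<open>auto simp: invs_def\<close>)
  have Pow_split: "Pow {..<Suc n} = (\<lambda>K. insert 0 (Suc ` K)) ` Pow {..<n} \<union> (`) Suc ` Pow {..<n}"
    by (simp add: lessThan_Suc_eq_insert_0 Pow_insert image_Pow_surj[OF refl, symmetric] image_image Un_commute)
  have "wedge_alt f g (v # vs) = (\<Sum>I\<in>Pow {..<Suc n}. h (Suc n) (v # vs) I)"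
    by (simp add: wedge_alt_def h_def invs_def n_def)
  also have "\<dots> = (\<Sum>I\<in>(\<lambda>K. insert 0 (Suc ` K)) ` Pow {..<n}. h (Suc n) (v # vs) I)
      + (\<Sum>I\<in>(`) Suc ` Pow {..<n}. h (Suc n) (v # vs) I)"
    unfolding Pow_split by (rule sum.union_disjoint) auto
  also have "(\<Sum>I\<in>(\<lambda>K. insert 0 (Suc ` K)) ` Pow {..<n}. h (Suc n) (v # vs) I)
      = (\<Sum>K\<in>Pow {..<n}. h (Suc n) (v # vs) (insert 0 (Suc ` K)))"
    by (subst sum.reindex) (auto simp: inj_on_def insert_eq_iff)
  also have "(\<Sum>I\<in>(`) Suc ` Pow {..<n}. h (Suc n) (v # vs) I)
      = (\<Sum>K\<in>Pow {..<n}. h (Suc n) (v # vs) (Suc ` K))"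
    by (subst sum.reindex) (auto simp: inj_on_def inj_image_eq_iff)
  also have "(\<Sum>K\<in>Pow {..<n}. h (Suc n) (v # vs) (insert 0 (Suc ` K))) =
      wedge_alt (\<lambda>us. f (v # us)) g vs"
    unfolding wedge_alt_def n_def[symmetric]
  proof (rule sum.cong)
    fix K assume K: "K \<in> Pow {..<n}"
    have "invs (Suc n) (insert 0 (Suc ` K)) = map_prod Suc Suc ` invs n K"
    proof (rule set_eqI)
      fix p show "p \<in> invs (Suc n) (insert 0 (Suc ` K)) \<longleftrightarrow> p \<in> map_prod Suc Suc ` invs n K"
        by (cases p, cases "fst p"; cases "snd p") (auto simp: invs_def image_iff Bex_def)
    qed
    then have "card (invs (Suc n) (insert 0 (Suc ` K))) = card (invs n K)"
      by (simp add: card_image inj_on_def map_prod_def split: prod.splits)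
    then show "h (Suc n) (v # vs) (insert 0 (Suc ` K)) =
        (- 1) ^ card {(i, j). i \<in> K \<and> j \<in> {..<n} - K \<and> j < i} * f (v # nths vs K) * g (nths vs (- K))"
      by (simp add: h_def invs_def nths_Cons Compl_eq inj_image_mem_iff)
  qed simp
  also have "(\<Sum>K\<in>Pow {..<n}. h (Suc n) (v # vs) (Suc ` K)) =
      wedge_alt (flip f) (\<lambda>us. g (v # us)) vs"
    unfolding wedge_alt_def n_def[symmetric]
  proof (rule sum.cong)
    fix K assume K: "K \<in> Pow {..<n}"
    \<comment> \<open>The second set consists of the inversions against position 0. There are
      \<open>card K\<close> of them, as many as \<open>f\<close> has arguments.\<close>
    have eq: "invs (Suc n) (Suc ` K) = map_prod Suc Suc ` invs n K \<union> (\<lambda>k. (Suc k, 0)) ` K"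
    proof (rule set_eqI)
      fix p show "p \<in> invs (Suc n) (Suc ` K) \<longleftrightarrow> p \<in> map_prod Suc Suc ` invs n K \<union> (\<lambda>k. (Suc k, 0)) ` K"
        by (cases p, cases "fst p"; cases "snd p") (auto simp: invs_def image_iff Bex_def)
    qed
    have "card (invs (Suc n) (Suc ` K)) = card (invs n K) + card K"
    proof -
      have "card (invs (Suc n) (Suc ` K)) =
          card (map_prod Suc Suc ` invs n K) + card ((\<lambda>k. (Suc k, 0 :: nat)) ` K)"
        unfolding eq using K finite_subset[of K "{..<n}"] fin[of K n]
        by (intro card_Un_disjoint) auto
      then show ?thesis
        by (simp add: card_image inj_on_def map_prod_def split: prod.splits)
    qed
    moreover have "length (nths vs K) = card K"
      using K by (auto simp: length_nths n_def intro!: arg_cong[where f = card])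
    ultimately show "h (Suc n) (v # vs) (Suc ` K) =
        (- 1) ^ card {(i, j). i \<in> K \<and> j \<in> {..<n} - K \<and> j < i} * flip f (nths vs K) * g (v # nths vs (- K))"
      by (simp add: h_def invs_def flip_def nths_Cons Compl_eq inj_image_mem_iff power_add mult_ac)
  qed simp
  finally show ?thesis .
qed

section \<open>Bilinearity and naturality of the shuffle product\<close>

lemma wedge_alt_add_left: "wedge_alt (\<lambda>vs. f vs + f' vs) g = (\<lambda>vs. wedge_alt f g vs + wedge_alt f' g vs)"
  by (rule ext) (simp add: wedge_alt_def algebra_simps sum.distrib)

lemma wedge_alt_add_right: "wedge_alt f (\<lambda>vs. g vs + g' vs) = (\<lambda>vs. wedge_alt f g vs + wedge_alt f g' vs)"
  by (rule ext) (simp add: wedge_alt_def algebra_simps sum.distrib)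

lemma wedge_alt_scale_left: "wedge_alt (\<lambda>vs. c * f vs) g = (\<lambda>vs. c * wedge_alt f g vs)"
  by (rule ext) (simp add: wedge_alt_def sum_distrib_left mult_ac)

lemma wedge_alt_scale_right: "wedge_alt f (\<lambda>vs. c * g vs) = (\<lambda>vs. c * wedge_alt f g vs)"
  by (rule ext) (simp add: wedge_alt_def sum_distrib_left mult_ac)

lemma wedge_alt_minus_left: "wedge_alt (\<lambda>vs. - f vs) g = (\<lambda>vs. - wedge_alt f g vs)"
  using wedge_alt_scale_left[of "- 1" f g] by simp

lemma wedge_alt_minus_right: "wedge_alt f (\<lambda>vs. - g vs) = (\<lambda>vs. - wedge_alt f g vs)"
  using wedge_alt_scale_right[of f "- 1" g] by simp

lemma wedge_alt_diff_left: "wedge_alt (\<lambda>vs. f vs - f' vs) g = (\<lambda>vs. wedge_alt f g vs - wedge_alt f' g vs)"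
  using wedge_alt_add_left[of f "\<lambda>vs. - f' vs" g] by (simp add: wedge_alt_minus_left)

lemma wedge_alt_diff_right: "wedge_alt f (\<lambda>vs. g vs - g' vs) = (\<lambda>vs. wedge_alt f g vs - wedge_alt f g' vs)"
  using wedge_alt_add_right[of f g "\<lambda>vs. - g' vs"] by (simp add: wedge_alt_minus_right)

lemma wedge_alt_zero_left [simp]: "wedge_alt (\<lambda>vs. 0) g = (\<lambda>vs. 0)"
  by (rule ext) (simp add: wedge_alt_def)

lemma wedge_alt_zero_right [simp]: "wedge_alt f (\<lambda>vs. 0) = (\<lambda>vs. 0)"
  by (rule ext) (simp add: wedge_alt_def)

lemma wedge_alt_map:
  "wedge_alt (\<lambda>us. f (map h us)) (\<lambda>us. g (map h us)) = (\<lambda>vs. wedge_alt f g (map h vs))"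
  by (rule ext) (simp add: wedge_alt_def nths_map)

section \<open>Grading, associativity and graded commutativity\<close>

lemma flip_flip [simp]: "flip (flip f) = f"
  by (rule ext) (simp add: flip_def mult.assoc[symmetric] power_add[symmetric])

lemma flip_Cons: "(\<lambda>us. flip f (v # us)) = (\<lambda>us. - flip (\<lambda>us. f (v # us)) us)"
  by (simp add: flip_def)

lemma flip_wedge_alt: "flip (wedge_alt f g) = wedge_alt (flip f) (flip g)"
proof
  fix vs show "flip (wedge_alt f g) vs = wedge_alt (flip f) (flip g) vs"
  proof (induction vs arbitrary: f g)
    case Nil show ?case by (simp add: flip_def)
  next
    case (Cons v vs)
    have "flip (wedge_alt f g) (v # vs) =
        - (flip (wedge_alt (\<lambda>us. f (v # us)) g) vs + flip (wedge_alt (flip f) (\<lambda>us. g (v # us))) vs)"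
      by (simp add: flip_def wedge_alt_Cons algebra_simps)
    then show ?case
      by (simp add: Cons.IH wedge_alt_Cons flip_Cons wedge_alt_minus_left wedge_alt_minus_right)
  qed
qed

text \<open>Contracting either side with \<open>v\<close> gives the same three products, one for
  each factor that receives \<open>v\<close>. In the third, \<open>v\<close> passes \<open>f\<close>
  and \<open>g\<close> together, which is where \<open>flip_wedge_alt\<close> enters.\<close>

lemma wedge_alt_assoc: "wedge_alt (wedge_alt f g) h = wedge_alt f (wedge_alt g h)"
proof
  fix vs show "wedge_alt (wedge_alt f g) h vs = wedge_alt f (wedge_alt g h) vs"
    by (induction vs arbitrary: f g h)
      (simp_all add: wedge_alt_Cons wedge_alt_add_left wedge_alt_add_right flip_wedge_alt algebra_simps)
qed

text \<open>Contraction changes the parity of \<open>f\<close>, so the even and the odd case need a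
  simultaneous induction. For odd \<open>f\<close> the sign depends on the degree of
  \<open>g\<close>, hence \<open>flip g\<close>.\<close>

lemma wedge_alt_commute_parity:
  "(\<forall>vs. odd (length vs) \<longrightarrow> f vs = 0) \<Longrightarrow> wedge_alt f g vs = wedge_alt g f vs"
  "(\<forall>vs. even (length vs) \<longrightarrow> f vs = 0) \<Longrightarrow> wedge_alt f g vs = wedge_alt (flip g) f vs"
proof (induction vs arbitrary: f g)
  case Nil
  {
    case 1 show ?case by (simp add: mult.commute)
  next
    case 2 then show ?case by simp
  }
next
  case (Cons v vs)
  {
    case 1
    then have "flip f = f"
      by (intro ext) (rename_tac us, case_tac "even (length us)"; simp add: flip_def)
    moreover have "wedge_alt f (\<lambda>us. g (v # us)) vs = wedge_alt (\<lambda>us. g (v # us)) f vs"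
      by (rule Cons.IH(1)) (use 1 in simp)
    moreover have "wedge_alt (\<lambda>us. f (v # us)) g vs = wedge_alt (flip g) (\<lambda>us. f (v # us)) vs"
      by (rule Cons.IH(2)) (use 1 in simp)
    ultimately show ?case by (simp add: wedge_alt_Cons)
  next
    case 2
    then have "flip f = (\<lambda>us. - f us)"
      by (intro ext) (rename_tac us, case_tac "even (length us)"; simp add: flip_def)
    moreover have "wedge_alt f (\<lambda>us. g (v # us)) vs = wedge_alt (flip (\<lambda>us. g (v # us))) f vs"
      by (rule Cons.IH(2)) (use 2 in simp)
    moreover have "wedge_alt (\<lambda>us. f (v # us)) g vs = wedge_alt g (\<lambda>us. f (v # us)) vs"
      by (rule Cons.IH(1)) (use 2 in simp)
    ultimately show ?case by (simp add: wedge_alt_Cons wedge_alt_minus_left flip_Cons)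
  }
qed

text \<open>A shuffle splits the positions into \<open>I\<close> and its complement, so the argument
  counts of the two factors add up to the length of the list.\<close>

lemma homogeneous_wedge_alt:
  assumes "homogeneous p f" "homogeneous q g"
  shows "homogeneous (p + q) (wedge_alt f g)"
  unfolding homogeneous_def
proof (intro allI impI)
  fix vs :: "'a list" assume "length vs \<noteq> p + q"
  moreover have "length (nths vs I) + length (nths vs (- I)) = length vs" for I
  proof -
    have "card {i. i < length vs \<and> i \<in> I} + card {i. i < length vs \<and> i \<in> - I} =
        card ({i. i < length vs \<and> i \<in> I} \<union> {i. i < length vs \<and> i \<in> - I})"
      by (subst card_Un_disjoint) auto
    also have "{i. i < length vs \<and> i \<in> I} \<union> {i. i < length vs \<and> i \<in> - I} = {..<length vs}"
      by auto
    finally show ?thesis by (simp add: length_nths)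
  qed
  ultimately have "length (nths vs I) \<noteq> p \<or> length (nths vs (- I)) \<noteq> q" for I
    by metis
  then have "f (nths vs I) = 0 \<or> g (nths vs (- I)) = 0" for I
    using assms unfolding homogeneous_def by blast
  then have "s * f (nths vs I) * g (nths vs (- I)) = 0" for s I
    by (metis mult_zero_left mult_zero_right)
  then show "wedge_alt f g vs = 0"
    by (simp add: wedge_alt_def)
qed

lemma homogeneous_flip: "homogeneous p f \<Longrightarrow> flip f = (\<lambda>vs. (- 1) ^ p * f vs)"
  by (auto simp: homogeneous_def flip_def fun_eq_iff)

lemma wedge_alt_commute_even:
  "homogeneous p f \<Longrightarrow> even p \<Longrightarrow> wedge_alt f g = wedge_alt g f"
  by (rule ext, rule wedge_alt_commute_parity(1)) (auto simp: homogeneous_def)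

lemma wedge_alt_commute_odd:
  "homogeneous p f \<Longrightarrow> odd p \<Longrightarrow> homogeneous q g \<Longrightarrow> odd q \<Longrightarrow>
    wedge_alt f g = (\<lambda>vs. - wedge_alt g f vs)"
  by (rule ext, subst wedge_alt_commute_parity(2))
    (auto simp: homogeneous_def[of p] homogeneous_flip[of q] wedge_alt_minus_left)

text \<open>Anticommutation makes the square equal to its own negative, and in characteristic zero
  one can divide by 2.\<close>

lemma wedge_alt_self_odd:
  fixes f :: "'v list \<Rightarrow> 'b::{idom, ring_char_0}"
  assumes "homogeneous p f" "odd p"
  shows "wedge_alt f f = (\<lambda>vs. 0)"
  using fun_cong[OF wedge_alt_commute_odd[OF assms assms]] by (simp add: fun_eq_iff eq_neg_iff_add_eq_0 mult_2[symmetric])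

section \<open>The exterior derivative\<close>

text \<open>The algebraic half of \<open>ext_d\<close>: if \<open>D v\<close> is the derivative of a
  field of forms in the direction \<open>v\<close>, this is its exterior derivative. Detached from
  analysis, the Leibniz rule can be proved by induction on lists.\<close>

definition alt_diff :: "('v \<Rightarrow> 'v list \<Rightarrow> 'b::comm_ring_1) \<Rightarrow> 'v list \<Rightarrow> 'b" where
  "alt_diff D vs = (\<Sum>k<length vs. (- 1) ^ k * D (vs ! k) (take k vs @ drop (Suc k) vs))"

lemma alt_diff_Nil [simp]: "alt_diff D [] = 0"
  by (simp add: alt_diff_def)

text \<open>Cartan's formula for a constant vector \<open>v\<close>: contracting the exterior
  derivative gives the derivative along \<open>v\<close> minus the exterior derivative of the
  contraction.\<close>

lemma alt_diff_Cons: "alt_diff D (v # vs) = D v vs - alt_diff (\<lambda>w us. D w (v # us)) vs"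
  by (simp add: alt_diff_def sum.lessThan_Suc_shift sum_negf del: sum.lessThan_Suc)

lemma alt_diff_add: "alt_diff (\<lambda>v vs. D v vs + D' v vs) = (\<lambda>vs. alt_diff D vs + alt_diff D' vs)"
  by (rule ext) (simp add: alt_diff_def algebra_simps sum.distrib)

lemma alt_diff_scale: "alt_diff (\<lambda>v vs. c * D v vs) = (\<lambda>vs. c * alt_diff D vs)"
  by (rule ext) (simp add: alt_diff_def sum_distrib_left mult_ac)

lemma alt_diff_zero [simp]: "alt_diff (\<lambda>v vs. 0) = (\<lambda>vs. 0)"
  by (rule ext) (simp add: alt_diff_def)

lemma alt_diff_map:
  "alt_diff (\<lambda>v us. D (h v) (map h us)) = (\<lambda>vs. alt_diff D (map h vs))"
  by (rule ext) (simp add: alt_diff_def take_map drop_map)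

lemma homogeneous_alt_diff:
  "(\<And>v. homogeneous p (D v)) \<Longrightarrow> homogeneous (Suc p) (alt_diff D)"
  by (fastforce simp: homogeneous_def alt_diff_def intro!: sum.neutral)

text \<open>Each summand evaluates \<open>D\<close> on a list shorter by one than \<open>vs\<close>,
  so the two parities are opposite.\<close>

lemma alt_diff_flip: "alt_diff (\<lambda>v. flip (D v)) = (\<lambda>vs. - flip (alt_diff D) vs)"
proof
  fix vs
  have "(- 1) ^ k * flip (D (vs ! k)) (take k vs @ drop (Suc k) vs) =
      - ((- 1) ^ length vs * ((- 1) ^ k * D (vs ! k) (take k vs @ drop (Suc k) vs)))"
    if "k < length vs" for k
  proof -
    have "length vs = Suc (length (take k vs @ drop (Suc k) vs))"
      using that by simp
    then show ?thesis by (simp only: flip_def power_Suc) (simp add: mult_ac)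
  qed
  then show "alt_diff (\<lambda>v. flip (D v)) vs = - flip (alt_diff D) vs"
    by (simp add: flip_def alt_diff_def sum_distrib_left sum_negf[symmetric])
qed

text \<open>Together with \<open>alt_diff_wedge_right\<close> this is the graded Leibniz rule, since
  the derivative of a product has one summand of each kind.\<close>

lemma alt_diff_wedge_left: "alt_diff (\<lambda>v. wedge_alt (D v) g) = wedge_alt (alt_diff D) g"
proof
  fix vs show "alt_diff (\<lambda>v. wedge_alt (D v) g) vs = wedge_alt (alt_diff D) g vs"
  proof (induction vs arbitrary: D g)
    case (Cons v vs)
    have "flip (alt_diff D) = (\<lambda>us. - alt_diff (\<lambda>w. flip (D w)) us)"
      by (simp add: alt_diff_flip)
    then show ?case
      by (simp add: alt_diff_Cons wedge_alt_Cons alt_diff_add Cons.IH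
          wedge_alt_diff_left wedge_alt_minus_left)
  qed simp
qed

lemma alt_diff_wedge_right: "alt_diff (\<lambda>v. wedge_alt f (D v)) = wedge_alt (flip f) (alt_diff D)"
proof
  fix vs show "alt_diff (\<lambda>v. wedge_alt f (D v)) vs = wedge_alt (flip f) (alt_diff D) vs"
    by (induction vs arbitrary: D f)
      (simp_all add: alt_diff_Cons wedge_alt_Cons alt_diff_add flip_Cons
        wedge_alt_diff_right wedge_alt_minus_left)
qed

text \<open>Differentiation takes place for each fixed list of arguments separately, so no topology
  on a space of forms is involved.\<close>

definition has_form_derivative ::
    "('e::real_normed_vector \<Rightarrow> 'v list \<Rightarrow> 'b::real_normed_field) \<Rightarrow> ('e \<Rightarrow> 'v list \<Rightarrow> 'b) \<Rightarrow> 'e \<Rightarrow> bool" where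
  "has_form_derivative F D x \<longleftrightarrow> (\<forall>vs. ((\<lambda>y. F y vs) has_derivative (\<lambda>v. D v vs)) (at x))"

lemma has_form_derivative_const: "has_form_derivative (\<lambda>y. f) (\<lambda>v vs. 0) x"
  by (simp add: has_form_derivative_def)

lemma has_form_derivative_add:
  "has_form_derivative F D x \<Longrightarrow> has_form_derivative G E x \<Longrightarrow>
    has_form_derivative (\<lambda>y vs. F y vs + G y vs) (\<lambda>v vs. D v vs + E v vs) x"
  by (auto simp: has_form_derivative_def intro: has_derivative_add)

lemma has_form_derivative_scale:
  "has_form_derivative F D x \<Longrightarrow> has_form_derivative (\<lambda>y vs. c * F y vs) (\<lambda>v vs. c * D v vs) x"
  by (auto simp: has_form_derivative_def intro: has_derivative_mult_right)

lemma has_form_derivative_wedge_alt: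
  assumes "has_form_derivative F D x" "has_form_derivative G E x"
  shows "has_form_derivative (\<lambda>y. wedge_alt (F y) (G y))
    (\<lambda>v vs. wedge_alt (D v) (G x) vs + wedge_alt (F x) (E v) vs) x"
  unfolding has_form_derivative_def
proof
  fix vs
  have F: "((\<lambda>y. F y us) has_derivative (\<lambda>v. D v us)) (at x)"
    and G: "((\<lambda>y. G y us) has_derivative (\<lambda>v. E v us)) (at x)" for us
    using assms by (auto simp: has_form_derivative_def)
  show "((\<lambda>y. wedge_alt (F y) (G y) vs) has_derivative
      (\<lambda>v. wedge_alt (D v) (G x) vs + wedge_alt (F x) (E v) vs)) (at x)"
    unfolding wedge_alt_def sum.distrib[symmetric]
    by (rule has_derivative_sum, rule has_derivative_eq_rhs,
        rule has_derivative_mult[OF has_derivative_mult_right[OF F] G])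
      (simp add: fun_eq_iff algebra_simps)
qed

lemma has_form_derivative_pull_fst:
  assumes "has_form_derivative F D (fst z)"
  shows "has_form_derivative (\<lambda>y vs. F (fst y) (map fst vs)) (\<lambda>v vs. D (fst v) (map fst vs)) z"
  unfolding has_form_derivative_def
proof
  fix vs
  show "((\<lambda>y. F (fst y) (map fst vs)) has_derivative (\<lambda>v. D (fst v) (map fst vs))) (at z)"
    by (rule has_derivative_compose[OF has_derivative_fst[OF has_derivative_ident]])
      (use assms in \<open>simp add: has_form_derivative_def\<close>)
qed

lemma ext_d_eq_alt_diff:
  assumes "has_form_derivative (F i) D x"
  shows "ext_d F i x = alt_diff D"
proof -
  have "frechet_derivative (\<lambda>y. F i y vs) (at x) = (\<lambda>v. D v vs)" for vs
    using assms by (simp add: has_form_derivative_def frechet_derivative_at[symmetric])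
  then show ?thesis
    by (simp add: ext_d_def alt_diff_def fun_eq_iff)
qed

text \<open>On a list of the wrong length the field vanishes throughout a neighbourhood of
  \<open>x\<close>, and derivatives are unique.\<close>

lemma has_form_derivative_homogeneous:
  assumes "has_form_derivative F D x" "open S" "x \<in> S" "\<And>y. y \<in> S \<Longrightarrow> homogeneous p (F y)"
  shows "homogeneous p (D v)"
  unfolding homogeneous_def
proof (intro allI impI)
  fix vs :: "'b list" assume len: "length vs \<noteq> p"
  have "((\<lambda>y. F y vs) has_derivative (\<lambda>v. 0)) (at x)"
    by (rule has_derivative_transform_within_open[OF has_derivative_const[of 0] assms(2,3)])
      (use assms(4) len in \<open>simp add: homogeneous_def\<close>)
  moreover have "((\<lambda>y. F y vs) has_derivative (\<lambda>v. D v vs)) (at x)"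
    using assms(1) by (simp add: has_form_derivative_def)
  ultimately have "(\<lambda>v. 0) = (\<lambda>v. D v vs)"
    by (rule has_derivative_unique)
  then show "D v vs = 0"
    by (rule fun_cong[symmetric])
qed

lemma has_form_derivativeI:
  assumes "\<And>vs. (\<lambda>y. F y vs) differentiable (at x)"
  shows "has_form_derivative F (\<lambda>v vs. frechet_derivative (\<lambda>y. F y vs) (at x) v) x"
  using assms by (simp add: has_form_derivative_def frechet_derivative_works[symmetric])

section \<open>Smooth functions: locality and slices\<close>

lemma smooth_on_imp_differentiable:
  assumes "smooth_on f S" "x \<in> S"
  shows "f differentiable (at x)"
  using assms(1)[unfolded smooth_on_def, rule_format, of "Suc 0"] assms(2) by simp

text \<open>At points of an open set the derivative depends only on the values on that set, so the
  agreement of \<open>f\<close> and \<open>g\<close> passes to every directional derivative.\<close>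

lemma Ck_on_cong:
  assumes "Ck_on k f S" "open S" "\<And>x. x \<in> S \<Longrightarrow> f x = g x"
  shows "Ck_on k g S"
  using assms
proof (induction k arbitrary: f g)
  case 0
  then show ?case using continuous_on_cong[OF refl, of S f g] by simp
next
  case (Suc k)
  have diff: "f differentiable (at x)" if "x \<in> S" for x
    using Suc.prems(1) that by simp
  have "g differentiable (at x)" if x: "x \<in> S" for x
  proof -
    obtain D where "(f has_derivative D) (at x)"
      using diff[OF x] by (auto simp: differentiable_def)
    then have "(g has_derivative D) (at x)"
      by (rule has_derivative_transform_within_open[OF _ Suc.prems(2) x Suc.prems(3)])
    then show ?thesis by (auto simp: differentiable_def)
  qed
  moreover have "Ck_on k (\<lambda>x. frechet_derivative g (at x) v) S" for v
  proof (rule Suc.IH[OF _ Suc.prems(2)])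
    show "Ck_on k (\<lambda>x. frechet_derivative f (at x) v) S"
      using Suc.prems(1) by simp
    show "frechet_derivative f (at x) v = frechet_derivative g (at x) v" if "x \<in> S" for x
      using frechet_derivative_transform_within_open[OF diff[OF that] Suc.prems(2) that Suc.prems(3)] by simp
  qed
  ultimately show ?case by simp
qed

text \<open>By the chain rule the derivative of the slice along \<open>v\<close> is the slice of the
  derivative along \<open>(v, 0)\<close>, to which the induction hypothesis applies.\<close>

lemma Ck_on_slice:
  assumes "Ck_on k f (A \<times> B)" "open A" "t \<in> B"
  shows "Ck_on k (\<lambda>y. f (y, t)) A"
  using assms
proof (induction k arbitrary: f)
  case 0
  have "continuous_on A (f \<circ> (\<lambda>y. (y, t)))"
    by (intro continuous_on_compose continuous_intros)
      (use 0 in \<open>auto intro: continuous_on_subset\<close>)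
  then show ?case by (simp add: o_def)
next
  case (Suc k)
  have D: "((\<lambda>y. f (y, t)) has_derivative (\<lambda>v. frechet_derivative f (at (y, t)) (v, 0))) (at y)"
    if "y \<in> A" for y
  proof (rule has_derivative_compose[of "\<lambda>y. (y, t)" "\<lambda>v. (v, 0)"])
    show "((\<lambda>y. (y, t)) has_derivative (\<lambda>v. (v, 0))) (at y)"
      by (auto intro!: derivative_eq_intros)
    show "(f has_derivative frechet_derivative f (at (y, t))) (at (y, t))"
      using Suc.prems that by (simp add: frechet_derivative_works[symmetric])
  qed
  have "Ck_on k (\<lambda>y. frechet_derivative (\<lambda>y. f (y, t)) (at y) v) A" for v
  proof (rule Ck_on_cong[OF _ Suc.prems(2)])
    show "Ck_on k (\<lambda>y. frechet_derivative f (at (y, t)) (v, 0)) A"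
      by (rule Suc.IH) (use Suc.prems in simp_all)
    show "frechet_derivative f (at (y, t)) (v, 0) = frechet_derivative (\<lambda>y. f (y, t)) (at y) v"
      if "y \<in> A" for y
      using fun_cong[OF frechet_derivative_at[OF D[OF that]]] .
  qed
  then show ?case
    using D by (auto simp: differentiable_def)
qed

lemma smooth_on_slice:
  "smooth_on f (A \<times> B) \<Longrightarrow> open A \<Longrightarrow> t \<in> B \<Longrightarrow> smooth_on (\<lambda>y. f (y, t)) A"
  unfolding smooth_on_def by (intro allI Ck_on_slice) simp_all

lemma smooth_on_const: "smooth_on (\<lambda>x. c) S"
proof -
  have "Ck_on k (\<lambda>x. c) S" for k and c :: 'b
    by (induction k arbitrary: c) (simp_all add: frechet_derivative_const)
  then show ?thesis by (simp add: smooth_on_def)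
qed

section \<open>The product with a circle\<close>

lemma cis_image_interval: "cis ` {a<..<a + 2 * pi} = sphere 0 1 - {cis a}"
proof (intro equalityI subsetI)
  fix z assume "z \<in> cis ` {a<..<a + 2 * pi}"
  then obtain s where s: "a < s" "s < a + 2 * pi" "z = cis s"
    by auto
  have "cis s \<noteq> cis a"
  proof
    assume "cis s = cis a"
    then have "sin s = sin a \<and> cos s = cos a" by (simp add: complex_eq_iff)
    then obtain n :: int where "s = a + 2 * pi * n" by (auto simp: sin_cos_eq_iff)
    \<comment> \<open>Equality would make \<open>s - a\<close> equal to \<open>2 * pi * n\<close>
      for an integer \<open>n\<close> strictly between 0 and 1.\<close>
    with s have "pi * 0 < pi * n" "pi * n < pi * 1" by auto
    then have "0 < n" "n < 1"
      unfolding mult_less_cancel_left_pos[OF pi_gt_zero] by simp_all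
    then show False by simp
  qed
  with s show "z \<in> sphere 0 1 - {cis a}" by simp
next
  fix z assume z: "z \<in> sphere 0 1 - {cis a}"
  \<comment> \<open>\<open>q\<close> counts the turns from the angle \<open>a\<close> to
    \<open>Arg z\<close>. Dropping its integral part moves the angle into the interval of length
    \<open>2 * pi\<close> starting at \<open>a\<close>; the left end point is excluded because
    \<open>z\<close> is not \<open>cis a\<close>.\<close>
  define q where "q = (Arg z - a) / (2 * pi)"
  define s where "s = a + 2 * pi * frac q"
  have q: "2 * pi * q = Arg z - a"
    by (simp add: q_def)
  have "cis (Arg z) = z"
    using z cis_Arg[of z] by (cases "z = 0") (simp_all add: sgn_div_norm)
  then have "z = cis (Arg z)"
    by (rule sym)
  also have "Arg z = s + 2 * pi * \<lfloor>q\<rfloor>"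
    using q by (simp add: s_def frac_def right_diff_distrib)
  also have "cis \<dots> = cis s"
  proof -
    have "sin (s + 2 * pi * \<lfloor>q\<rfloor>) = sin s \<and> cos (s + 2 * pi * \<lfloor>q\<rfloor>) = cos s"
      unfolding sin_cos_eq_iff by blast
    then show ?thesis by (simp only: complex_eq_iff cis.simps)
  qed
  finally have zs: "z = cis s" .
  have "frac q \<noteq> 0"
  proof
    assume "frac q = 0"
    then have "s = a" by (simp add: s_def)
    with z zs show False by simp
  qed
  then have "0 < frac q"
    using frac_ge_0[of q] by linarith
  then have "s \<in> {a<..<a + 2 * pi}"
    using frac_lt_1[of q] by (simp add: s_def)
  with zs show "z \<in> cis ` {a<..<a + 2 * pi}" by blast
qed

text \<open>Two angles in the interval with the same image under \<open>cis\<close> differ by a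
  multiple of \<open>2 * pi\<close> of modulus less than \<open>2 * pi\<close>. Hence
  \<open>cis\<close> is injective there and the chart really inverts it.\<close>

lemma cran_circle: "cran circle a = {a<..<a + 2 * pi}"
proof -
  have "inj_on cis {a<..<a + 2 * pi}"
  proof
    fix s t assume st: "s \<in> {a<..<a + 2 * pi}" "t \<in> {a<..<a + 2 * pi}" "cis s = cis t"
    then have "sin s = sin t \<and> cos s = cos t" by (simp add: complex_eq_iff)
    then obtain n :: int where n: "s = t + 2 * pi * n" by (auto simp: sin_cos_eq_iff)
    have "a < s" "s < a + 2 * pi" "a < t" "t < a + 2 * pi"
      using st by simp_all
    with n have "pi * (-1) < pi * n" "pi * n < pi * 1"
      by linarith+
    then have "- 1 < n" "n < 1"
      unfolding mult_less_cancel_left_pos[OF pi_gt_zero] by simp_all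
    with n show "s = t" by simp
  qed
  then have "bij_betw cis {a<..<a + 2 * pi} (sphere 0 1 - {cis a})"
    by (simp add: bij_betw_def cis_image_interval)
  from bij_betw_inv_into[OF this] show ?thesis
    by (simp add: cran_def circle_def bij_betw_def)
qed

section \<open>Charts and transition maps of a product\<close>

lemma image_Times: "(\<lambda>p. (f (fst p), g (snd p))) ` (A \<times> B) = f ` A \<times> g ` B"
proof
  show "f ` A \<times> g ` B \<subseteq> (\<lambda>p. (f (fst p), g (snd p))) ` (A \<times> B)"
  proof clarify
    fix x y assume "x \<in> A" "y \<in> B"
    then show "(f x, g y) \<in> (\<lambda>p. (f (fst p), g (snd p))) ` (A \<times> B)"
      by (intro image_eqI[of _ _ "(x, y)"]) simp_all
  qed
qed auto

lemma cran_prod_manifold: "cran (prod_manifold M M') (i, j) = cran M i \<times> cran M' j"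
  by (simp add: cran_def prod_manifold_def image_Times)

lemma overlap_prod_manifold:
  "overlap (prod_manifold M M') (i, i') (j, j') = overlap M i j \<times> overlap M' i' j'"
  by (simp add: overlap_def prod_manifold_def Times_Int_Times image_Times)

lemma overlap_self: "overlap M i i = cran M i"
  by (simp add: overlap_def cran_def)

lemma trans_map_prod_manifold_self:
  assumes "inj_on (cmap M i) (cdom M i)" "x \<in> cran M i" "t \<in> cran M' a"
  shows "trans_map (prod_manifold M M') (i, a) (j, a) (x, t) = (trans_map M i j x, t)"
proof -
  define A where "A = cdom (prod_manifold M M') (i, a)"
  define f where "f = cmap (prod_manifold M M') (i, a)"
  define z where "z = inv_into A f (x, t)"
  have "(x, t) \<in> f ` A"
    using assms(2,3) cran_prod_manifold[of M M' i a] by (simp add: cran_def A_def f_def)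
  then have "z \<in> A" "f z = (x, t)"
    by (simp_all add: z_def inv_into_into f_inv_into_f)
  then have z: "fst z \<in> cdom M i" "cmap M i (fst z) = x" "cmap M' a (snd z) = t"
    by (simp_all add: A_def f_def prod_manifold_def mem_Times_iff)
  then have "inv_into (cdom M i) (cmap M i) x = fst z"
    using inv_into_f_f[OF assms(1) z(1)] by simp
  moreover have "trans_map (prod_manifold M M') (i, a) (j, a) (x, t) = (cmap M j (fst z), cmap M' a (snd z))"
    unfolding z_def A_def f_def by (simp add: trans_map_def prod_manifold_def)
  ultimately show ?thesis
    by (simp add: trans_map_def z(3))
qed

lemma smooth_manifold_open_cran: "smooth_manifold M \<Longrightarrow> i \<in> charts M \<Longrightarrow> open (cran M i)"
  by (simp add: smooth_manifold_def)

lemma smooth_manifold_inj_on: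
  assumes "smooth_manifold M" "i \<in> charts M"
  shows "inj_on (cmap M i) (cdom M i)"
proof -
  have "openin (points M) (cdom M i)"
    "homeomorphic_map (subtopology (points M) (cdom M i)) (top_of_set (cran M i)) (cmap M i)"
    using assms by (simp_all add: smooth_manifold_def)
  then show ?thesis
    by (auto dest!: homeomorphic_imp_injective_map openin_subset simp: Int_absorb1)
qed

lemma smooth_manifold_open_overlap:
  assumes "smooth_manifold M" "i \<in> charts M" "j \<in> charts M"
  shows "open (overlap M i j)"
proof -
  have "openin (points M) (cdom M i)" "openin (points M) (cdom M j)"
    and hm: "homeomorphic_map (subtopology (points M) (cdom M i)) (top_of_set (cran M i)) (cmap M i)"
    using assms by (simp_all add: smooth_manifold_def)
  then have "openin (subtopology (points M) (cdom M i)) (cdom M i \<inter> cdom M j)"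
    by (simp add: openin_open_subtopology openin_Int)
  then have "openin (top_of_set (cran M i)) (overlap M i j)"
    using homeomorphic_imp_open_map[OF hm] by (simp add: open_map_def overlap_def)
  then show ?thesis
    using smooth_manifold_open_cran[OF assms(1,2)] by (simp add: openin_open_eq)
qed

text \<open>On an open set around the point the transition map is the product of
  \<open>trans_map M i j\<close> with the identity, hence so is its derivative.\<close>

lemma trans_deriv_prod_manifold_self:
  assumes M: "smooth_manifold M" "i \<in> charts M" "j \<in> charts M"
    and x: "x \<in> overlap M i j" and t: "t \<in> cran M' a" "open (cran M' a)"
  shows "trans_deriv (prod_manifold M M') (i, a) (j, a) (x, t) (v, s) = (trans_deriv M i j x v, s)"
proof -
  have "smooth_on (trans_map M i j) (overlap M i j)"
    using M by (simp add: smooth_manifold_def)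
  from smooth_on_imp_differentiable[OF this x]
  have "(trans_map M i j has_derivative trans_deriv M i j x) (at x)"
    by (simp add: trans_deriv_def frechet_derivative_works[symmetric])
  then have "(trans_map M i j has_derivative trans_deriv M i j x) (at (fst (x, t)))"
    by simp
  from has_derivative_Pair[OF has_derivative_compose[OF has_derivative_fst[OF has_derivative_ident] this]
      has_derivative_snd[OF has_derivative_ident]]
  have "((\<lambda>z. (trans_map M i j (fst z), snd z)) has_derivative
      (\<lambda>w. (trans_deriv M i j x (fst w), snd w))) (at (x, t))" .
  then have "(trans_map (prod_manifold M M') (i, a) (j, a) has_derivative
      (\<lambda>w. (trans_deriv M i j x (fst w), snd w))) (at (x, t))"
  proof (rule has_derivative_transform_within_open)
    show "open (overlap M i j \<times> cran M' a)"
      by (intro open_Times smooth_manifold_open_overlap M t)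
    have "overlap M i j \<subseteq> cran M i" by (auto simp: overlap_def cran_def)
    then show "(trans_map M i j (fst z), snd z) = trans_map (prod_manifold M M') (i, a) (j, a) z"
      if "z \<in> overlap M i j \<times> cran M' a" for z
      using that trans_map_prod_manifold_self[OF smooth_manifold_inj_on[OF M(1,2)], of "fst z" "snd z" M' a j]
      by (simp add: mem_Times_iff subset_iff)
  qed (use x t in auto)
  from frechet_derivative_at[OF this] show ?thesis
    by (simp add: trans_deriv_def fun_eq_iff)
qed

section \<open>Forms on the product: \<open>dt\<close>, pull-backs from the first factor, and the
  derivatives of the two structure forms\<close>

definition tau :: "('e \<times> real) list \<Rightarrow> real" where
  "tau vs = (if length vs = 1 then snd (vs ! 0) else 0)"

lemma pull_snd_dt: "pull_snd dt c z = tau"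
  by (auto simp: fun_eq_iff pull_snd_def dt_def tau_def)

lemma homogeneous_tau: "homogeneous 1 tau"
  by (simp add: homogeneous_def tau_def)

definition lift :: "('e list \<Rightarrow> real) \<Rightarrow> ('e \<times> real) list \<Rightarrow> real" where
  "lift f vs = f (map fst vs)"

lemma lift_wedge_alt: "lift (wedge_alt f g) = wedge_alt (lift f) (lift g)"
  by (rule ext) (simp only: lift_def[abs_def] wedge_alt_map)

lemma homogeneous_lift: "homogeneous p f \<Longrightarrow> homogeneous p (lift f)"
  by (simp add: homogeneous_def lift_def)

lemma lift_zero [simp]: "lift (\<lambda>vs. 0) = (\<lambda>vs. 0)"
  by (simp add: fun_eq_iff lift_def)

lemma pull_fst_eq_lift: "pull_fst F c z = lift (F (fst c) (fst z))"
  by (simp add: pull_fst_def lift_def fun_eq_iff)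

lemma has_form_derivative_lift:
  "has_form_derivative F D x \<Longrightarrow> has_form_derivative (\<lambda>z. lift (F (fst z))) (\<lambda>v. lift (D (fst v))) (x, t)"
  using has_form_derivative_pull_fst[of F D "(x, t)"] by (simp add: lift_def[abs_def])

lemma alt_diff_lift: "alt_diff (\<lambda>v. lift (D (fst v))) = lift (alt_diff D)"
  unfolding lift_def[abs_def] by (rule alt_diff_map)

lemma flip_even: "homogeneous p f \<Longrightarrow> even p \<Longrightarrow> flip f = f"
  by (simp add: homogeneous_flip)

lemma rho_at:
  "rho \<omega> \<psi> (i, a) z = (\<lambda>vs. lift (\<omega> i (fst z)) vs + wedge_alt (lift (re_form \<psi> i (fst z))) tau vs
     + (- 1 / 6) * wedge_alt (lift (\<omega> i (fst z))) (wedge_alt (lift (\<omega> i (fst z))) (lift (\<omega> i (fst z)))) vs)"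
  by (simp add: rho_def form_plus_def form_scale_def wedge_def pull_fst_eq_lift pull_snd_dt)

lemma rho_hat_at:
  "rho_hat \<omega> \<psi> (i, a) z = (\<lambda>vs. tau vs + (- 1) * lift (im_form \<psi> i (fst z)) vs
     + (- 1 / 2) * wedge_alt (lift (\<omega> i (fst z))) (wedge_alt (lift (\<omega> i (fst z))) tau) vs)"
  by (simp add: rho_hat_def form_plus_def form_scale_def wedge_def pull_fst_eq_lift pull_snd_dt)

text \<open>The form \<open>tau\<close> is constant and contributes no derivative, and \<omega> has
  even degree, so the Leibniz rule brings no signs. The three summands from the cube of \<omega>
  stay separate, since the formula is applied before d\<omega> = 0 is known.\<close>

lemma ext_d_rho:
  assumes W: "has_form_derivative (\<omega> i) W x" and P: "has_form_derivative (re_form \<psi> i) P x"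
    and hom: "homogeneous 2 (\<omega> i x)"
  shows "ext_d (rho \<omega> \<psi>) (i, a) (x, t) = (\<lambda>vs. lift (alt_diff W) vs + wedge_alt (lift (alt_diff P)) tau vs
     + (- 1 / 6) * (wedge_alt (lift (alt_diff W)) (wedge_alt (lift (\<omega> i x)) (lift (\<omega> i x))) vs
       + wedge_alt (lift (\<omega> i x)) (\<lambda>us. wedge_alt (lift (alt_diff W)) (lift (\<omega> i x)) us
           + wedge_alt (lift (\<omega> i x)) (lift (alt_diff W)) us) vs))"
proof -
  note w = has_form_derivative_lift[OF W, of t]
  have fl: "flip (lift (\<omega> i x)) = lift (\<omega> i x)"
    by (rule flip_even[OF homogeneous_lift[OF hom]]) simp
  show ?thesis
    apply (subst ext_d_eq_alt_diff)
     apply (unfold rho_at[abs_def])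
     \<comment> \<open>The rules follow the syntactic structure of the form and thereby build the
       derivative that \<open>ext_d_eq_alt_diff\<close> leaves open.\<close>
     apply (rule has_form_derivative_add has_form_derivative_scale has_form_derivative_wedge_alt
        w has_form_derivative_lift[OF P] has_form_derivative_const)+
    apply (simp only: alt_diff_add alt_diff_scale alt_diff_wedge_left alt_diff_wedge_right alt_diff_lift fl fst_conv
        wedge_alt_zero_right alt_diff_zero add_0_right)
    done
qed

lemma ext_d_rho_hat:
  assumes W: "has_form_derivative (\<omega> i) W x" and Q: "has_form_derivative (im_form \<psi> i) Q x"
    and hom: "homogeneous 2 (\<omega> i x)"
  shows "ext_d (rho_hat \<omega> \<psi>) (i, a) (x, t) = (\<lambda>vs. (- 1) * lift (alt_diff Q) vs
     + (- 1 / 2) * (wedge_alt (lift (alt_diff W)) (wedge_alt (lift (\<omega> i x)) tau) vs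
       + wedge_alt (lift (\<omega> i x)) (wedge_alt (lift (alt_diff W)) tau) vs))"
proof -
  note w = has_form_derivative_lift[OF W, of t]
  have fl: "flip (lift (\<omega> i x)) = lift (\<omega> i x)"
    by (rule flip_even[OF homogeneous_lift[OF hom]]) simp
  show ?thesis
    apply (subst ext_d_eq_alt_diff)
     apply (unfold rho_hat_at[abs_def])
     apply (rule has_form_derivative_add has_form_derivative_scale has_form_derivative_wedge_alt
        w has_form_derivative_lift[OF Q] has_form_derivative_const)+
    apply (simp only: alt_diff_add alt_diff_scale alt_diff_wedge_left alt_diff_wedge_right alt_diff_lift fl fst_conv
        wedge_alt_zero_right alt_diff_zero add_0_right add_0_left)
    done
qed

section \<open>Pointwise algebra of SU(3)-structures\<close>

lemma alternating_form_homogeneous: "alternating_form k f \<Longrightarrow> homogeneous k f"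
  by (simp add: alternating_form_def homogeneous_def)

lemma alternating_form_2_linear:
  assumes "alternating_form 2 p"
  shows "linear (\<lambda>v. p [v, w])" "linear (\<lambda>w. p [v, w])"
proof -
  have "linear (\<lambda>u. p ([v, w][i := u]))" if "i < 2" for i v w
    using assms that unfolding alternating_form_def by (metis length_Cons list.size(3) numeral_2_eq_2)
  from this[of 0 v w] this[of 1 v w] show "linear (\<lambda>v. p [v, w])" "linear (\<lambda>w. p [v, w])"
    by simp_all
qed

lemma alternating_form_2_self:
  assumes "alternating_form 2 p"
  shows "p [v, v] = 0"
  using assms unfolding alternating_form_def
  by (metis One_nat_def length_Cons list.size(3) nth_Cons_0 nth_Cons_Suc numeral_2_eq_2 zero_less_one lessI)

lemma alternating_form_2_antisym:
  assumes "alternating_form 2 p"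
  shows "p [v, w] = - p [w, v]"
proof -
  have "p [v + w, v + w] = p [v, v] + p [v, w] + (p [w, v] + p [w, w])"
    by (simp add: linear_add[OF alternating_form_2_linear(1)[OF assms]]
        linear_add[OF alternating_form_2_linear(2)[OF assms]])
  then show ?thesis
    by (simp add: alternating_form_2_self[OF assms] eq_neg_iff_add_eq_0)
qed

lemma wedge_alt_2_2:
  assumes "homogeneous 2 f" "homogeneous 2 g"
  shows "wedge_alt f g [a, b, c, d] = f [a, b] * g [c, d] - f [a, c] * g [b, d] + f [a, d] * g [b, c]
     + f [b, c] * g [a, d] - f [b, d] * g [a, c] + f [c, d] * g [a, b]"
  by (simp add: wedge_alt_Cons flip_def homogeneousD[OF assms(1)] homogeneousD[OF assms(2)])

lemma wedge_alt_2_3: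
  assumes "homogeneous 2 f" "homogeneous 3 g"
  shows "wedge_alt f g [a, b, c, d, e] = f [a, b] * g [c, d, e] - f [a, c] * g [b, d, e]
     + f [a, d] * g [b, c, e] - f [a, e] * g [b, c, d] + f [b, c] * g [a, d, e] - f [b, d] * g [a, c, e]
     + f [b, e] * g [a, c, d] + f [c, d] * g [a, b, e] - f [c, e] * g [a, b, d] + f [d, e] * g [a, b, c]"
  by (simp add: wedge_alt_Cons flip_def homogeneousD[OF assms(1)] homogeneousD[OF assms(2)])

lemma sum_1_6: "(\<Sum>k = 1..6::nat. f k) = f 1 + f 2 + f 3 + f 4 + f 5 + f 6"
  by (simp add: eval_nat_numeral)

lemma set_1_6: "{1..6::nat} = {1, 2, 3, 4, 5, 6}"
  by auto

text \<open>The equations for \<open>J\<close> correspond to \<open>J b\<^sub>1 = b\<^sub>2\<close>, \<open>J b\<^sub>3 = b\<^sub>4\<close> and \<open>J b\<^sub>5 = b\<^sub>6\<close>.\<close>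

locale su3_frame =
  fixes e :: "nat \<Rightarrow> 'v::real_vector list \<Rightarrow> real" and b :: "nat \<Rightarrow> 'v" and J :: "'v \<Rightarrow> 'v"
  assumes hom_e: "k \<in> {1..6} \<Longrightarrow> homogeneous 1 (e k)"
    and dual: "k \<in> {1..6} \<Longrightarrow> l \<in> {1..6} \<Longrightarrow> e k [b l] = (if k = l then 1 else 0)"
    and expansion: "v = (\<Sum>k = 1..6. e k [v] *\<^sub>R b k)"
    and e_J: "e 1 [J v] = - e 2 [v]" "e 2 [J v] = e 1 [v]" "e 3 [J v] = - e 4 [v]"
      "e 4 [J v] = e 3 [v]" "e 5 [J v] = - e 6 [v]" "e 6 [J v] = e 5 [v]"
begin

text \<open>Keeps the coframe index 1 from being rewritten to \<open>Suc 0\<close>.\<close>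

declare One_nat_def [simp del]

definition om :: "'v list \<Rightarrow> real" where
  "om = (\<lambda>vs. wedge_alt (e 1) (e 2) vs + wedge_alt (e 3) (e 4) vs + wedge_alt (e 5) (e 6) vs)"

text \<open>For the index pairs 1 2, 3 4 and 5 6 these are the basic covectors of type (1,0), as the
  equations \<open>e_J\<close> show.\<close>

definition theta :: "nat \<Rightarrow> nat \<Rightarrow> 'v list \<Rightarrow> complex" where
  "theta k l = (\<lambda>vs. Complex (e k vs) (e l vs))"

definition ps :: "'v list \<Rightarrow> complex" where
  "ps = wedge_alt (theta 1 2) (wedge_alt (theta 3 4) (theta 5 6))"

lemma hom_theta: "k \<in> {1..6} \<Longrightarrow> l \<in> {1..6} \<Longrightarrow> homogeneous 1 (theta k l)"
  using hom_e[of k] hom_e[of l] by (auto simp: homogeneous_def theta_def Complex_eq_0)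

lemma hom_om: "homogeneous 2 om"
  using homogeneous_wedge_alt[OF hom_e[of 1] hom_e[of 2]] homogeneous_wedge_alt[OF hom_e[of 3] hom_e[of 4]]
    homogeneous_wedge_alt[OF hom_e[of 5] hom_e[of 6]]
  by (simp add: om_def homogeneous_def)

lemma hom_ps: "homogeneous 3 ps"
  using homogeneous_wedge_alt[OF hom_theta[of 1 2] homogeneous_wedge_alt[OF hom_theta[of 3 4] hom_theta[of 5 6]]]
  by (simp add: ps_def)

lemma e_length: "k \<in> {1..6} \<Longrightarrow> length vs \<noteq> Suc 0 \<Longrightarrow> e k vs = 0"
  using hom_e by (simp add: homogeneous_def One_nat_def)

lemma om_eval: "om [v, w] = e 1 [v] * e 2 [w] - e 2 [v] * e 1 [w] + e 3 [v] * e 4 [w] - e 4 [v] * e 3 [w]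
    + e 5 [v] * e 6 [w] - e 6 [v] * e 5 [w]"
  by (simp add: om_def wedge_alt_Cons flip_def e_length)

lemma linear_expand:
  fixes f :: "'v \<Rightarrow> real"
  assumes "linear f"
  shows "f v = e 1 [v] * f (b 1) + e 2 [v] * f (b 2) + e 3 [v] * f (b 3) + e 4 [v] * f (b 4)
    + e 5 [v] * f (b 5) + e 6 [v] * f (b 6)"
proof -
  have "f v = f (\<Sum>k = 1..6. e k [v] *\<^sub>R b k)"
    using expansion[of v] by simp
  also have "\<dots> = (\<Sum>k = 1..6. e k [v] * f (b k))"
    by (simp add: linear_sum[OF assms] linear_scale[OF assms])
  finally show ?thesis by (simp only: sum_1_6)
qed

lemma form_2_expand:
  assumes "alternating_form 2 p"
  shows "p [v, w] = e 1 [v] * p [b 1, w] + e 2 [v] * p [b 2, w] + e 3 [v] * p [b 3, w] + e 4 [v] * p [b 4, w]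
    + e 5 [v] * p [b 5, w] + e 6 [v] * p [b 6, w]"
  by (rule linear_expand[OF alternating_form_2_linear(1)[OF assms]])

lemma form_2_expand_right:
  assumes "alternating_form 2 p"
  shows "p [v, w] = e 1 [w] * p [v, b 1] + e 2 [w] * p [v, b 2] + e 3 [w] * p [v, b 3] + e 4 [w] * p [v, b 4]
    + e 5 [w] * p [v, b 5] + e 6 [w] * p [v, b 6]"
  by (rule linear_expand[OF alternating_form_2_linear(2)[OF assms]])

text \<open>A real 2-form of type (1,1) lies in the ideal of the (1,0)-forms \<open>\<theta>\<close>: the combination
  \<open>\<theta>\<^sub>k \<and> (\<iota>\<^bsub>b\<^esub> p - \<i> \<iota>\<^bsub>J b\<^esub> p)\<close>, summed over the complex directions, has vanishing imaginary part exactly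
  because of the invariance.\<close>

lemma invariant_decomposition:
  assumes p: "alternating_form 2 p" and inv: "\<And>v w. p [J v, J w] = p [v, w]" and JJ: "\<And>v. J (J v) = - v"
  defines "lam k l \<equiv> (\<lambda>vs. if length vs = Suc 0 then Complex (p [b k, vs ! 0]) (- p [b l, vs ! 0]) else 0)"
  shows "(\<lambda>vs. 2 * complex_of_real (p vs)) = (\<lambda>vs. wedge_alt (theta 1 2) (lam 1 2) vs
    + wedge_alt (theta 3 4) (lam 3 4) vs + wedge_alt (theta 5 6) (lam 5 6) vs)"
proof
  fix vs
  have lam: "homogeneous 1 (lam k l)" for k l
    by (simp add: lam_def homogeneous_def One_nat_def)
  show "2 * complex_of_real (p vs) = wedge_alt (theta 1 2) (lam 1 2) vs
    + wedge_alt (theta 3 4) (lam 3 4) vs + wedge_alt (theta 5 6) (lam 5 6) vs"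
  proof (cases "length vs = 2")
    case False
    moreover have "wedge_alt (theta k l) (lam k l) vs = 0" if "k \<in> {1..6}" "l \<in> {1..6}" for k l
      using homogeneous_wedge_alt[OF hom_theta[OF that] lam[of k l]] False by (simp add: homogeneous_def)
    ultimately show ?thesis
      using alternating_form_homogeneous[OF p] by (simp add: homogeneous_def)
  next
    case True
    then obtain v w where vs: "vs = [v, w]"
      by (auto simp: numeral_2_eq_2 length_Suc_conv)
    \<comment> \<open>Expanded in the frame, the imaginary part of the right-hand side is
      \<open>p [J w, v] - p [J v, w]\<close>, and the real part is
      \<open>p [v, w] - p [w, v]\<close>. Invariance makes the former vanish.\<close>
    have "p [J v, w] = - p [v, J w]" for v w
      using inv[of v "J w"] linear_neg[OF alternating_form_2_linear(2)[OF p, of "J v"], of w]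
      by (simp add: JJ)
    then have sym: "p [J v, w] = p [J w, v]"
      using alternating_form_2_antisym[OF p] by metis
    have ev: "wedge_alt (theta k l) (lam k l) vs = Complex (e k [v]) (e l [v]) * Complex (p [b k, w]) (- p [b l, w])
        - Complex (e k [w]) (e l [w]) * Complex (p [b k, v]) (- p [b l, v])" if "k \<in> {1..6}" "l \<in> {1..6}" for k l
      using e_length that by (simp add: vs wedge_alt_Cons flip_def theta_def lam_def Complex_eq_0 complex_eq_iff)
    show ?thesis
      unfolding vs complex_eq_iff
      using form_2_expand[OF p, of v w] form_2_expand[OF p, of w v] alternating_form_2_antisym[OF p, of w v]
        form_2_expand[OF p, of "J v" w] form_2_expand[OF p, of "J w" v] sym
      by (simp add: ev[unfolded vs] e_J)
  qed
qed

text \<open>Twice \<open>p\<close> lies in the ideal generated by the three (1,0)-forms. Each of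
  them is a factor of \<open>ps\<close> and squares to zero, so it annihilates
  \<open>ps\<close>.\<close>

lemma invariant_wedge_ps:
  assumes p: "alternating_form 2 p" and inv: "\<And>v w. p [J v, J w] = p [v, w]" and JJ: "\<And>v. J (J v) = - v"
  shows "wedge_alt (\<lambda>vs. complex_of_real (p vs)) ps = (\<lambda>vs. 0)"
proof -
  define lam where "lam k l = (\<lambda>vs. if length vs = Suc 0 then Complex (p [b k, vs ! 0]) (- p [b l, vs ! 0]) else 0)"
    for k l
  have lam: "homogeneous 1 (lam k l)" for k l
    by (simp add: lam_def homogeneous_def One_nat_def)
  have sq: "wedge_alt (theta k l) (wedge_alt (theta k l) f) = (\<lambda>vs. 0)" if "k \<in> {1..6}" "l \<in> {1..6}" for k l f
    unfolding wedge_alt_assoc[symmetric] wedge_alt_self_odd[OF hom_theta[OF that] odd_one] by simp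
  have swap: "wedge_alt f (wedge_alt g h) = (\<lambda>vs. - wedge_alt g (wedge_alt f h) vs)"
    if "homogeneous 1 f" "homogeneous 1 g" for f g h :: "'v list \<Rightarrow> complex"
    unfolding wedge_alt_assoc[symmetric] wedge_alt_commute_odd[OF that(1) odd_one that(2) odd_one]
    by (simp add: wedge_alt_minus_left)
  have t: "homogeneous 1 (theta 1 2)" "homogeneous 1 (theta 3 4)" "homogeneous 1 (theta 5 6)"
    by (simp_all add: hom_theta)
  have z1: "wedge_alt (theta 1 2) ps = (\<lambda>vs. 0)"
    by (simp add: ps_def sq)
  have z2: "wedge_alt (theta 3 4) ps = (\<lambda>vs. 0)"
    by (simp add: ps_def swap[OF t(2) t(1)] sq)
  have z3: "wedge_alt (theta 5 6) ps = (\<lambda>vs. 0)"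
    by (simp add: ps_def swap[OF t(3) t(1)] swap[OF t(3) t(2)] wedge_alt_minus_right
        wedge_alt_self_odd[OF t(3) odd_one])
  \<comment> \<open>Interchanging the two 1-forms brings \<open>theta k l\<close> next to
    \<open>ps\<close>.\<close>
  have zero: "wedge_alt (wedge_alt (theta k l) (lam k l)) ps = (\<lambda>vs. 0)"
    if "wedge_alt (theta k l) ps = (\<lambda>vs. 0)" "k \<in> {1..6}" "l \<in> {1..6}" for k l
    unfolding wedge_alt_commute_odd[OF hom_theta[OF that(2,3)] odd_one lam odd_one]
    by (simp add: wedge_alt_minus_left wedge_alt_assoc that(1))
  have "wedge_alt (\<lambda>vs. 2 * complex_of_real (p vs)) ps = (\<lambda>vs. 0)"
    unfolding invariant_decomposition[OF p inv JJ]
    by (simp add: wedge_alt_add_left lam_def[symmetric] zero z1 z2 z3)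
  then show ?thesis
    by (simp add: wedge_alt_scale_left fun_eq_iff)
qed

text \<open>Evaluation on two complex lines gives the sum of the two corresponding diagonal
  coefficients; three vanishing pairwise sums force all three coefficients to vanish. Evaluation on
  two vectors from different lines together with the remaining line isolates one mixed
  coefficient.\<close>

lemma wedge_om_inject:
  assumes p: "alternating_form 2 p" and zero: "\<And>vs. wedge_alt p om vs = 0"
  shows "p vs = 0"
proof -
  note ev = wedge_alt_2_2[OF alternating_form_homogeneous[OF p] hom_om]
  note z = zero[of "[b _, b _, b _, b _]", unfolded ev om_eval]
  have zz: "p [b 1, b 2] = 0" "p [b 3, b 4] = 0" "p [b 5, b 6] = 0"
    using z[of 1 2 3 4] z[of 1 2 5 6] z[of 3 4 5 6] by (simp_all add: dual)
  moreover have "p [b 1, b 3] = 0" using z[of 1 3 5 6] by (simp add: dual)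
  moreover have "p [b 1, b 4] = 0" using z[of 1 4 5 6] by (simp add: dual)
  moreover have "p [b 2, b 3] = 0" using z[of 2 3 5 6] by (simp add: dual)
  moreover have "p [b 2, b 4] = 0" using z[of 2 4 5 6] by (simp add: dual)
  moreover have "p [b 1, b 5] = 0" using z[of 1 5 3 4] by (simp add: dual)
  moreover have "p [b 1, b 6] = 0" using z[of 1 6 3 4] by (simp add: dual)
  moreover have "p [b 2, b 5] = 0" using z[of 2 5 3 4] by (simp add: dual)
  moreover have "p [b 2, b 6] = 0" using z[of 2 6 3 4] by (simp add: dual)
  moreover have "p [b 3, b 5] = 0" using z[of 3 5 1 2] by (simp add: dual)
  moreover have "p [b 3, b 6] = 0" using z[of 3 6 1 2] by (simp add: dual)
  moreover have "p [b 4, b 5] = 0" using z[of 4 5 1 2] by (simp add: dual)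
  moreover have "p [b 4, b 6] = 0" using z[of 4 6 1 2] by (simp add: dual)
  ultimately have bb: "p [b k, b l] = 0" if "k \<in> {1..6}" "l \<in> {1..6}" "k < l" for k l
    using that unfolding set_1_6 by (elim insertE emptyE) simp_all
  have "p [b k, b l] = 0" if "k \<in> {1..6}" "l \<in> {1..6}" for k l
    using bb[OF that] bb[OF that(2,1)] alternating_form_2_self[OF p] alternating_form_2_antisym[OF p, of "b k" "b l"]
    by (cases k l rule: linorder_cases) auto
  then have "p [v, b l] = 0" if "l \<in> {1..6}" for v l
    unfolding form_2_expand[OF p, of v] using that by simp
  then have "p [v, w] = 0" for v w
    unfolding form_2_expand_right[OF p, of v w] by simp
  then show ?thesis
    using alternating_form_homogeneous[OF p]
    by (cases "length vs = 2") (auto simp: homogeneous_def numeral_2_eq_2 length_Suc_conv)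
qed

text \<open>The value of \<open>ps\<close> is the complex 3 by 3 determinant of the (1,0)-forms on
  the three vectors, expanded along \<open>theta 1 2\<close>.\<close>

lemma Im_ps_eval: "Im (ps [u, v, w]) =
    Im (Complex (e 1 [u]) (e 2 [u]) * (Complex (e 3 [v]) (e 4 [v]) * Complex (e 5 [w]) (e 6 [w]) - Complex (e 3 [w]) (e 4 [w]) * Complex (e 5 [v]) (e 6 [v])))
  - Im (Complex (e 1 [v]) (e 2 [v]) * (Complex (e 3 [u]) (e 4 [u]) * Complex (e 5 [w]) (e 6 [w]) - Complex (e 3 [w]) (e 4 [w]) * Complex (e 5 [u]) (e 6 [u])))
  + Im (Complex (e 1 [w]) (e 2 [w]) * (Complex (e 3 [u]) (e 4 [u]) * Complex (e 5 [v]) (e 6 [v]) - Complex (e 3 [v]) (e 4 [v]) * Complex (e 5 [u]) (e 6 [u])))"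
proof -
  have th: "theta k l vs = 0" if "k \<in> {1..6}" "l \<in> {1..6}" "length vs \<noteq> Suc 0" for k l vs
    using hom_theta[OF that(1,2)] that(3) by (simp add: homogeneous_def One_nat_def)
  have "ps [u, v, w] =
    theta 1 2 [u] * (theta 3 4 [v] * theta 5 6 [w] - theta 3 4 [w] * theta 5 6 [v])
  - theta 1 2 [v] * (theta 3 4 [u] * theta 5 6 [w] - theta 3 4 [w] * theta 5 6 [u])
  + theta 1 2 [w] * (theta 3 4 [u] * theta 5 6 [v] - theta 3 4 [v] * theta 5 6 [u])"
    by (simp add: ps_def wedge_alt_Cons flip_def th)
  then show ?thesis by (simp add: theta_def)
qed

lemma form_2_expand_pairs:
  assumes p: "alternating_form 2 p"
  shows "p [v, w] = (e 1 [v] * e 2 [w] - e 2 [v] * e 1 [w]) * p [b 1, b 2] + (e 1 [v] * e 3 [w] - e 3 [v] * e 1 [w]) * p [b 1, b 3]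
      + (e 1 [v] * e 4 [w] - e 4 [v] * e 1 [w]) * p [b 1, b 4] + (e 1 [v] * e 5 [w] - e 5 [v] * e 1 [w]) * p [b 1, b 5]
      + (e 1 [v] * e 6 [w] - e 6 [v] * e 1 [w]) * p [b 1, b 6] + (e 2 [v] * e 3 [w] - e 3 [v] * e 2 [w]) * p [b 2, b 3]
      + (e 2 [v] * e 4 [w] - e 4 [v] * e 2 [w]) * p [b 2, b 4] + (e 2 [v] * e 5 [w] - e 5 [v] * e 2 [w]) * p [b 2, b 5]
      + (e 2 [v] * e 6 [w] - e 6 [v] * e 2 [w]) * p [b 2, b 6] + (e 3 [v] * e 4 [w] - e 4 [v] * e 3 [w]) * p [b 3, b 4]
      + (e 3 [v] * e 5 [w] - e 5 [v] * e 3 [w]) * p [b 3, b 5] + (e 3 [v] * e 6 [w] - e 6 [v] * e 3 [w]) * p [b 3, b 6]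
      + (e 4 [v] * e 5 [w] - e 5 [v] * e 4 [w]) * p [b 4, b 5] + (e 4 [v] * e 6 [w] - e 6 [v] * e 4 [w]) * p [b 4, b 6]
      + (e 5 [v] * e 6 [w] - e 6 [v] * e 5 [w]) * p [b 5, b 6]"
proof -
  have "p [v, w] = e 1 [v] * X 1 + e 2 [v] * X 2 + e 3 [v] * X 3 + e 4 [v] * X 4 + e 5 [v] * X 5 + e 6 [v] * X 6"
    if "\<And>k. X k = e 1 [w] * p [b k, b 1] + e 2 [w] * p [b k, b 2] + e 3 [w] * p [b k, b 3]
      + e 4 [w] * p [b k, b 4] + e 5 [w] * p [b k, b 5] + e 6 [w] * p [b k, b 6]" for X
    using form_2_expand[OF p, of v w] by (simp only: that form_2_expand_right[OF p, of "b _" w])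
  \<comment> \<open>Reflexivity instantiates \<open>X k\<close> with the expansion of
    \<open>p [b k, w]\<close>, so each argument is expanded exactly once.\<close>
  note this[OF refl]
  then show ?thesis
    by (simp add: alternating_form_2_self[OF p] alternating_form_2_antisym[OF p, of "b 2" "b 1"]
       alternating_form_2_antisym[OF p, of "b 3" "b 1"]
        alternating_form_2_antisym[OF p, of "b 4" "b 1"] alternating_form_2_antisym[OF p, of "b 5" "b 1"]
        alternating_form_2_antisym[OF p, of "b 6" "b 1"] alternating_form_2_antisym[OF p, of "b 3" "b 2"]
        alternating_form_2_antisym[OF p, of "b 4" "b 2"] alternating_form_2_antisym[OF p, of "b 5" "b 2"]
        alternating_form_2_antisym[OF p, of "b 6" "b 2"] alternating_form_2_antisym[OF p, of "b 4" "b 3"]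
        alternating_form_2_antisym[OF p, of "b 5" "b 3"] alternating_form_2_antisym[OF p, of "b 6" "b 3"]
        alternating_form_2_antisym[OF p, of "b 5" "b 4"] alternating_form_2_antisym[OF p, of "b 6" "b 4"]
        alternating_form_2_antisym[OF p, of "b 6" "b 5"] algebra_simps)
qed

text \<open>The six lists of five frame vectors, each omitting one of them, give six linear
  equations. They say that the mixed coefficients of \<open>p\<close> are compatible with
  \<open>J\<close>; the coefficients on the three complex lines are invariant in any case.\<close>

lemma wedge_Im_ps_imp_invariant:
  assumes p: "alternating_form 2 p" and zero: "\<And>vs. wedge_alt p (\<lambda>us. Im (ps us)) vs = 0"
  shows "p [J v, J w] = p [v, w]"
proof -
  have "homogeneous 3 (\<lambda>us. Im (ps us))"
    using hom_ps by (simp add: homogeneous_def)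
  note ev = wedge_alt_2_3[OF alternating_form_homogeneous[OF p] this]
  note z = zero[of "[b _, b _, b _, b _, b _]", unfolded ev Im_ps_eval]
  have "p [b 3, b 5] = p [b 4, b 6]" using z[of 2 3 4 5 6] by (simp add: dual)
  moreover have "p [b 3, b 6] = - p [b 4, b 5]" using z[of 1 3 4 5 6] by (simp add: dual)
  moreover have "p [b 1, b 5] = p [b 2, b 6]" using z[of 1 2 4 5 6] by (simp add: dual)
  moreover have "p [b 1, b 6] = - p [b 2, b 5]" using z[of 1 2 3 5 6] by (simp add: dual)
  moreover have "p [b 1, b 3] = p [b 2, b 4]" using z[of 1 2 3 4 6] by (simp add: dual)
  moreover have "p [b 1, b 4] = - p [b 2, b 3]" using z[of 1 2 3 4 5] by (simp add: dual)
  ultimately show ?thesis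
    unfolding form_2_expand_pairs[OF p, of v w] form_2_expand_pairs[OF p, of "J v" "J w"] e_J
    by (simp add: algebra_simps)
qed

end

section \<open>Strong integrability at a point\<close>

definition emb :: "'e \<Rightarrow> 'e \<times> real" where
  "emb v = (v, 0)"

lemma lift_map_emb [simp]: "lift f (map emb us) = f us"
  by (simp add: lift_def emb_def o_def)

lemma wedge_alt_tau_map_emb: "wedge_alt f tau (map emb us) = 0"
proof (induction us arbitrary: f)
  case Nil then show ?case by (simp add: tau_def)
next
  case (Cons u us)
  have "(\<lambda>vs. tau (emb u # vs)) = (\<lambda>vs. 0)"
    by (auto simp: tau_def emb_def)
  then show ?case by (simp add: wedge_alt_Cons Cons.IH)
qed

text \<open>Only the shuffle that hands the last vector to \<open>tau\<close> survives, and it has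
  no inversion. This reads off the coefficient of \<open>dt\<close> without a sign.\<close>

lemma wedge_alt_tau_snoc: "wedge_alt f tau (map emb us @ [(w, 1)]) = f (map emb us)"
proof (induction us arbitrary: f)
  case Nil show ?case by (simp add: wedge_alt_Cons tau_def flip_def)
next
  case (Cons u us)
  have "(\<lambda>vs. tau (emb u # vs)) = (\<lambda>vs. 0)"
    by (auto simp: tau_def emb_def)
  then show ?case by (simp add: wedge_alt_Cons Cons.IH)
qed

lemma tau_tau [simp]: "wedge_alt tau tau = (\<lambda>vs. 0)"
  by (rule wedge_alt_self_odd[OF homogeneous_tau odd_one])

lemma wedge_alt_2_1:
  assumes "homogeneous 2 f" "homogeneous 1 g"
  shows "wedge_alt f g [a, b, c] = f [a, b] * g [c] - f [a, c] * g [b] + f [b, c] * g [a]"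
  by (simp add: wedge_alt_Cons flip_def homogeneousD[OF assms(1)] homogeneousD[OF assms(2)])

lemma alternating_form_3:
  fixes f :: "'v::real_vector list \<Rightarrow> real"
  assumes f: "alternating_form 3 f"
  shows "linear (\<lambda>v. f [v, b, c])" "linear (\<lambda>v. f [a, v, c])" "linear (\<lambda>v. f [a, b, v])"
    and "f [a, a, c] = 0" "f [a, c, c] = 0" "f [a, c, a] = 0"
    and "f [a, c, b] = - f [a, b, c]" "f [b, a, c] = - f [a, b, c]"
proof -
  have l: "linear (\<lambda>u. f ([a, b, c][i := u]))" if "i < 3" for i a b c
    using f that unfolding alternating_form_def by (metis length_Cons list.size(3) numeral_3_eq_3)
  show l1: "linear (\<lambda>v. f [v, b, c])" for b c
    using l[of 0 undefined b c] by simp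
  show l2: "linear (\<lambda>v. f [a, v, c])" for a c
    using l[of 1 a undefined c] by simp
  show l3: "linear (\<lambda>v. f [a, b, v])" for a b
    using l[of 2 a b undefined] by (simp add: numeral_2_eq_2)
  have z: "f vs = 0" if "length vs = 3" "i < j" "j < 3" "vs ! i = vs ! j" for vs i j
    using f that unfolding alternating_form_def by blast
  show z1: "f [a, a, c] = 0" for a c
    using z[of "[a, a, c]" 0 1] by simp
  show z2: "f [a, c, c] = 0" for a c
    using z[of "[a, c, c]" 1 2] by (simp add: numeral_2_eq_2)
  show "f [a, c, a] = 0"
    using z[of "[a, c, a]" 0 2] by (simp add: numeral_2_eq_2)
  have "f [a, b + c, b + c] = f [a, b, b] + f [a, b, c] + (f [a, c, b] + f [a, c, c])"
    by (simp add: linear_add[OF l2] linear_add[OF l3])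
  then show "f [a, c, b] = - f [a, b, c]"
    using z2[of a "b + c"] z2[of a b] z2[of a c] by linarith
  have "f [a + b, a + b, c] = f [a, a, c] + f [a, b, c] + (f [b, a, c] + f [b, b, c])"
    by (simp add: linear_add[OF l2] linear_add[OF l1])
  then show "f [b, a, c] = - f [a, b, c]"
    using z1[of "a + b" c] z1[of a c] z1[of b c] by linarith
qed

text \<open>Contraction with the unit vector in the direction of t, restricted to vectors of the
  first factor. The last slot is used so that wedging with \<open>tau\<close> on the right undoes it
  without a sign.\<close>

definition contract_t :: "(('e::real_vector \<times> real) list \<Rightarrow> real) \<Rightarrow> 'e list \<Rightarrow> real" where
  "contract_t f vs = (if length vs = 2 then f (map emb vs @ [(0, 1)]) else 0)"

lemma alternating_form_contract_t:
  assumes "alternating_form 3 f"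
  shows "alternating_form 2 (contract_t f)"
proof -
  have lin: "linear emb"
    by (auto simp: emb_def linear_iff)
  have "linear (\<lambda>v. contract_t f (vs[i := v]))" if "length vs = 2" "i < 2" for vs :: "'a list" and i
  proof -
    have "linear (\<lambda>u. f ((map emb vs @ [(0, 1)])[i := u]))"
      using assms that unfolding alternating_form_def by simp
    from linear_compose[OF lin this] show ?thesis
      using that by (simp add: contract_t_def o_def map_update list_update_append)
  qed
  moreover have "contract_t f vs = 0" if "length vs = 2" "i < j" "j < 2" "vs ! i = vs ! j" for vs :: "'a list" and i j
  proof -
    have "(map emb vs @ [(0, 1)]) ! i = (map emb vs @ [(0, 1)]) ! j"
      using that by (simp add: nth_append)
    moreover have "length (map emb vs @ [(0::'a, 1::real)]) = 3" "j < 3"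
      using that by simp_all
    ultimately have "f (map emb vs @ [(0, 1)]) = 0"
      using assms that(2) unfolding alternating_form_def by blast
    then show ?thesis by (simp add: contract_t_def)
  qed
  ultimately show ?thesis
    unfolding alternating_form_def by (auto simp: contract_t_def)
qed

text \<open>Splitting each argument into an embedded vector and a multiple of \<open>T\<close> gives
  eight terms. The one without \<open>T\<close> vanishes by assumption and those with a repeated
  \<open>T\<close> by alternation, which leaves the three with a single \<open>T\<close>.\<close>

lemma alternating_form_3_eq_wedge_tau:
  fixes f :: "('e::real_vector \<times> real) list \<Rightarrow> real"
  assumes f: "alternating_form 3 f" and zero: "\<And>us. f (map emb us) = 0"
  shows "f = wedge_alt (lift (contract_t f)) tau"
proof
  fix vs
  have hom: "homogeneous 2 (lift (contract_t f))"
    by (intro homogeneous_lift) (simp add: homogeneous_def contract_t_def)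
  show "f vs = wedge_alt (lift (contract_t f)) tau vs"
  proof (cases "length vs = 3")
    case False
    then show ?thesis
      using homogeneous_wedge_alt[OF hom homogeneous_tau] f
      by (simp add: homogeneous_def alternating_form_def)
  next
    case True
    then obtain a b c where vs: "vs = [a, b, c]"
      by (auto simp: numeral_3_eq_3 length_Suc_conv)
    define T :: "'e \<times> real" where "T = (0, 1)"
    have split: "v = emb (fst v) + snd v *\<^sub>R T" for v :: "'e \<times> real"
      by (simp add: emb_def T_def prod_eq_iff)
    note l = alternating_form_3(1-3)[OF f]
    have lin: "f [v + r *\<^sub>R w, y, z] = f [v, y, z] + r * f [w, y, z]"
      "f [y, v + r *\<^sub>R w, z] = f [y, v, z] + r * f [y, w, z]"
      "f [y, z, v + r *\<^sub>R w] = f [y, z, v] + r * f [y, z, w]" for v w y z r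
      using linear_add[OF l(1), of v "r *\<^sub>R w"] linear_scale[OF l(1), of r w]
        linear_add[OF l(2), of y v "r *\<^sub>R w"] linear_scale[OF l(2), of y r w]
        linear_add[OF l(3), of y z v "r *\<^sub>R w"] linear_scale[OF l(3), of y z r w]
      by simp_all
    have e0: "f [emb x, emb y, emb z] = 0" for x y z
      using zero[of "[x, y, z]"] by simp
    have "f [a, b, c] = f [emb (fst a) + snd a *\<^sub>R T, emb (fst b) + snd b *\<^sub>R T, emb (fst c) + snd c *\<^sub>R T]"
      by (simp only: split[symmetric])
    also have "\<dots> = snd c * f [emb (fst a), emb (fst b), T] + snd b * f [emb (fst a), T, emb (fst c)]
        + snd a * f [T, emb (fst b), emb (fst c)]"
      by (simp only: lin e0 alternating_form_3(4-6)[OF f]) (simp add: algebra_simps)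
    \<comment> \<open>Moving \<open>T\<close> to the last slot costs one transposition here and two
      in the next term, which gives the signs of the shuffle formula.\<close>
    also have "f [emb (fst a), T, emb (fst c)] = - f [emb (fst a), emb (fst c), T]"
      by (rule alternating_form_3(7)[OF f])
    also have "f [T, emb (fst b), emb (fst c)] = f [emb (fst b), emb (fst c), T]"
      using alternating_form_3(7)[OF f, of "emb (fst b)" T "emb (fst c)"] alternating_form_3(8)[OF f, of T "emb (fst b)" "emb (fst c)"]
      by simp
    finally show ?thesis
      unfolding vs wedge_alt_2_1[OF hom homogeneous_tau]
      by (simp add: lift_def contract_t_def tau_def T_def)
  qed
qed

lemma tau_commute:
  assumes "homogeneous p f"
  shows "wedge_alt tau f = (\<lambda>vs. (- 1) ^ p * wedge_alt f tau vs)"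
proof (cases "even p")
  case True
  then show ?thesis using wedge_alt_commute_even[OF assms, of tau] by simp
next
  case False
  then show ?thesis using wedge_alt_commute_odd[OF homogeneous_tau _ assms] by simp
qed

lemma homogeneous_eq_zeroI:
  assumes "homogeneous p f" "\<And>vs. length vs = p \<Longrightarrow> f vs = 0"
  shows "f = (\<lambda>vs. 0)"
  using assms by (auto simp: homogeneous_def fun_eq_iff)

text \<open>Everything is now at a single point: \<open>W\<close>, \<open>P\<close> and
  \<open>Q\<close> are the derivatives of \<omega>, \<psi>_+ and \<psi>_-, so
  \<open>alt_diff\<close> turns them into the exterior derivatives.\<close>

context
  fixes \<omega> :: "('i, 'e::euclidean_space, real) form_field" and \<psi> :: "('i, 'e, complex) form_field"
    and i :: 'i and x :: 'e and t a :: real and W P Q :: "'e \<Rightarrow> 'e list \<Rightarrow> real"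
  assumes W: "has_form_derivative (\<omega> i) W x" and P: "has_form_derivative (re_form \<psi> i) P x"
    and Q: "has_form_derivative (im_form \<psi> i) Q x"
    and hom_W: "homogeneous 3 (alt_diff W)" and hom_P: "homogeneous 4 (alt_diff P)"
    and hom_Q: "homogeneous 4 (alt_diff Q)"
    and hom_omega: "homogeneous 2 (\<omega> i x)" and hom_re: "homogeneous 3 (re_form \<psi> i x)"
    and hom_im: "homogeneous 3 (im_form \<psi> i x)"
begin

text \<open>The terms separate by degree, into 3, 5, 7, 9 for the first equation and, once d\<omega>
  = 0, into 4, 6, 8 for the second. Within a degree, embedded vectors isolate the part without
  \<open>dt\<close>, and a final \<open>(0, 1)\<close> isolates the coefficient of
  \<open>dt\<close>.\<close>

lemma pointwise_integrable_imp:
  assumes H: "alternating_form 3 H"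
    and rho: "\<And>vs. ext_d (rho \<omega> \<psi>) (i, a) (x, t) vs + wedge_alt H (rho \<omega> \<psi> (i, a) (x, t)) vs = 0"
    and rho_hat: "\<And>vs. ext_d (rho_hat \<omega> \<psi>) (i, a) (x, t) vs + wedge_alt H (rho_hat \<omega> \<psi> (i, a) (x, t)) vs = 0"
  shows "alt_diff W = (\<lambda>vs. 0)" "alt_diff Q = (\<lambda>vs. 0)"
    and "alt_diff P = (\<lambda>vs. - wedge_alt (contract_t H) (\<omega> i x) vs)"
    and "wedge_alt (contract_t H) (im_form \<psi> i x) = (\<lambda>vs. 0)"
    and "H = wedge_alt (lift (contract_t H)) tau"
proof -
  note hom_H = alternating_form_homogeneous[OF H]
  note homs = homogeneous_lift[OF hom_W] homogeneous_lift[OF hom_P] homogeneous_lift[OF hom_Q]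
    homogeneous_lift[OF hom_omega] homogeneous_lift[OF hom_re] homogeneous_lift[OF hom_im]
    hom_H homogeneous_tau
  let ?w = "lift (\<omega> i x)"
  have H_rho: "wedge_alt H (rho \<omega> \<psi> (i, a) (x, t)) vs = wedge_alt H ?w vs
      + wedge_alt H (wedge_alt (lift (re_form \<psi> i x)) tau) vs
      + (- 1 / 6) * wedge_alt H (wedge_alt ?w (wedge_alt ?w ?w)) vs" for vs
    by (simp only: rho_at fst_conv wedge_alt_add_right wedge_alt_scale_right)
  have H_rho_hat: "wedge_alt H (rho_hat \<omega> \<psi> (i, a) (x, t)) vs = wedge_alt H tau vs
      + (- 1) * wedge_alt H (lift (im_form \<psi> i x)) vs
      + (- 1 / 2) * wedge_alt H (wedge_alt ?w (wedge_alt ?w tau)) vs" for vs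
    by (simp only: rho_hat_at fst_conv wedge_alt_add_right wedge_alt_scale_right)
  note hw = homogeneous_wedge_alt
  have h5: "homogeneous 5 (wedge_alt H ?w)" "homogeneous 5 (wedge_alt (lift (alt_diff P)) tau)"
    using hw[OF homs(7,4)] hw[OF homs(2,8)] by simp_all
  have h7: "homogeneous 7 (wedge_alt H (wedge_alt (lift (re_form \<psi> i x)) tau))"
    "homogeneous 7 (wedge_alt (lift (alt_diff W)) (wedge_alt ?w ?w))"
    "homogeneous 7 (wedge_alt ?w (wedge_alt (lift (alt_diff W)) ?w))"
    "homogeneous 7 (wedge_alt ?w (wedge_alt ?w (lift (alt_diff W))))"
    using hw[OF homs(7) hw[OF homs(5,8)]] hw[OF homs(1) hw[OF homs(4,4)]]
      hw[OF homs(4) hw[OF homs(1,4)]] hw[OF homs(4) hw[OF homs(4,1)]] by simp_all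
  have h9: "homogeneous 9 (wedge_alt H (wedge_alt ?w (wedge_alt ?w ?w)))"
    using hw[OF homs(7) hw[OF homs(4) hw[OF homs(4,4)]]] by simp
  have h4: "homogeneous 4 (wedge_alt H tau)"
    using hw[OF homs(7,8)] by simp
  have h6: "homogeneous 6 (wedge_alt H (lift (im_form \<psi> i x)))"
    using hw[OF homs(7,6)] by simp
  have h8: "homogeneous 8 (wedge_alt H (wedge_alt ?w (wedge_alt ?w tau)))"
    using hw[OF homs(7) hw[OF homs(4) hw[OF homs(4,8)]]] by simp
  note hD = homogeneousD
  show W0: "alt_diff W = (\<lambda>vs. 0)"
  proof (rule homogeneous_eq_zeroI[OF hom_W])
    fix us :: "'e list" assume "length us = 3"
    then have len: "length (map emb us) = 3" by simp
    show "alt_diff W us = 0"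
      using rho[of "map emb us"] len
      unfolding ext_d_rho[where \<omega> = \<omega> and \<psi> = \<psi> and i = i and x = x, OF W P hom_omega] H_rho wedge_alt_add_right
      by (simp add: h5[THEN hD] h7[THEN hD] h9[THEN hD])
  qed
  have d_rho: "ext_d (rho \<omega> \<psi>) (i, a) (x, t) = wedge_alt (lift (alt_diff P)) tau"
    unfolding ext_d_rho[where \<omega> = \<omega> and \<psi> = \<psi> and i = i and x = x, OF W P hom_omega] by (simp add: W0)
  have d_rho_hat: "ext_d (rho_hat \<omega> \<psi>) (i, a) (x, t) = (\<lambda>vs. - lift (alt_diff Q) vs)"
    unfolding ext_d_rho_hat[where \<omega> = \<omega> and \<psi> = \<psi> and i = i and x = x, OF W Q hom_omega] by (simp add: W0)
  \<comment> \<open>These are the only two terms of degree 4. On embedded vectors the right-hand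
    side vanishes, which gives d\<psi>_- = 0; with \<open>(0, 1)\<close> appended it then shows that
    \<open>H\<close> vanishes on embedded vectors.\<close>
  have deg4: "lift (alt_diff Q) vs = wedge_alt H tau vs" if "length vs = 4" for vs
    using rho_hat[of vs] that unfolding d_rho_hat H_rho_hat
    by (simp add: h6[THEN hD] h8[THEN hD])
  show Q0: "alt_diff Q = (\<lambda>vs. 0)"
  proof (rule homogeneous_eq_zeroI[OF hom_Q])
    fix us :: "'e list" assume "length us = 4"
    then show "alt_diff Q us = 0"
      using deg4[of "map emb us"] by (simp add: wedge_alt_tau_map_emb)
  qed
  have H_emb: "H (map emb us) = 0" for us
  proof (cases "length us = 3")
    case True
    then show ?thesis
      using deg4[of "map emb us @ [(0, 1)]"] by (simp add: Q0 wedge_alt_tau_snoc)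
  qed (simp add: hom_H[THEN hD])
  from alternating_form_3_eq_wedge_tau[OF H this] show H_eq: "H = wedge_alt (lift (contract_t H)) tau"
    .
  define p where "p = contract_t H"
  have hom_p: "homogeneous 2 p"
    by (simp add: p_def homogeneous_def contract_t_def)
  note H_eq' = H_eq[folded p_def]
  \<comment> \<open>Moving \<open>tau\<close> to the right costs nothing past \<omega> and a sign
    past \<psi>_-, which has odd degree.\<close>
  have Hw: "wedge_alt H ?w = wedge_alt (lift (wedge_alt p (\<omega> i x))) tau"
    by (subst H_eq') (simp add: wedge_alt_assoc tau_commute[OF homs(4)] lift_wedge_alt)
  have Hi: "wedge_alt H (lift (im_form \<psi> i x)) = (\<lambda>vs. - wedge_alt (lift (wedge_alt p (im_form \<psi> i x))) tau vs)"
    by (subst H_eq') (simp add: wedge_alt_assoc tau_commute[OF homs(6)] lift_wedge_alt wedge_alt_minus_right)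
  have "(\<lambda>vs. alt_diff P vs + wedge_alt p (\<omega> i x) vs) = (\<lambda>vs. 0)"
  proof (rule homogeneous_eq_zeroI[of 4])
    show "homogeneous 4 (\<lambda>vs. alt_diff P vs + wedge_alt p (\<omega> i x) vs)"
      using hom_P hw[OF hom_p hom_omega] by (simp add: homogeneous_def)
    fix us :: "'e list" assume "length us = 4"
    then show "alt_diff P us + wedge_alt p (\<omega> i x) us = 0"
      using rho[of "map emb us @ [(0, 1)]"] unfolding d_rho H_rho
      by (simp add: h7[THEN hD] h9[THEN hD] Hw wedge_alt_tau_snoc)
  qed
  then show "alt_diff P = (\<lambda>vs. - wedge_alt (contract_t H) (\<omega> i x) vs)"
    by (simp add: fun_eq_iff p_def eq_neg_iff_add_eq_0)
  show "wedge_alt (contract_t H) (im_form \<psi> i x) = (\<lambda>vs. 0)"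
    unfolding p_def[symmetric]
  proof (rule homogeneous_eq_zeroI[of 5])
    show "homogeneous 5 (wedge_alt p (im_form \<psi> i x))"
      using hw[OF hom_p hom_im] by simp
    fix us :: "'e list" assume "length us = 5"
    then show "wedge_alt p (im_form \<psi> i x) us = 0"
      using rho_hat[of "map emb us @ [(0, 1)]"] unfolding d_rho_hat H_rho_hat
      by (simp add: h4[THEN hD] h8[THEN hD] Hi wedge_alt_tau_snoc Q0 H_emb)
  qed
qed

text \<open>The product of \<open>H\<close> with \<omega> cancels the term of d\<psi>_+. Every other
  product with \<open>H\<close> vanishes because it contains \<open>tau\<close> twice, or
  \<open>p\<close> with \<psi>_-, or \<open>p\<close> with the square of \<omega>.\<close>

lemma pointwise_integrable:
  assumes H: "H = wedge_alt (lift p) tau" and hom_p: "homogeneous 2 p"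
    and W0: "alt_diff W = (\<lambda>vs. 0)" and Q0: "alt_diff Q = (\<lambda>vs. 0)"
    and dP: "alt_diff P = (\<lambda>vs. - wedge_alt p (\<omega> i x) vs)"
    and p_im: "wedge_alt p (im_form \<psi> i x) = (\<lambda>vs. 0)"
    and p_prim: "wedge_alt p (wedge_alt (\<omega> i x) (\<omega> i x)) = (\<lambda>vs. 0)"
  shows "ext_d (rho \<omega> \<psi>) (i, a) (x, t) vs + wedge_alt H (rho \<omega> \<psi> (i, a) (x, t)) vs = 0"
    and "ext_d (rho_hat \<omega> \<psi>) (i, a) (x, t) vs + wedge_alt H (rho_hat \<omega> \<psi> (i, a) (x, t)) vs = 0"
proof -
  let ?w = "lift (\<omega> i x)"
  let ?p = "lift p"
  note tc = tau_commute[OF homogeneous_lift[OF hom_omega]] tau_commute[OF homogeneous_lift[OF hom_re]]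
    tau_commute[OF homogeneous_lift[OF hom_im]]
  have w_comm: "wedge_alt tau (wedge_alt ?w f) = wedge_alt ?w (wedge_alt tau f)" for f
    using tc(1) by (simp add: wedge_alt_assoc[symmetric])
  have pww: "wedge_alt ?p (wedge_alt ?w (wedge_alt ?w f)) = (\<lambda>vs. 0)" for f
  proof -
    have "wedge_alt ?p (wedge_alt ?w (wedge_alt ?w f)) = wedge_alt (lift (wedge_alt p (wedge_alt (\<omega> i x) (\<omega> i x)))) f"
      by (simp only: lift_wedge_alt wedge_alt_assoc)
    then show ?thesis by (simp add: p_prim)
  qed
  have p_im': "wedge_alt ?p (lift (im_form \<psi> i x)) = (\<lambda>vs. 0)"
    by (simp add: lift_wedge_alt[symmetric] p_im)
  have a1: "wedge_alt H ?w = wedge_alt (wedge_alt ?p ?w) tau"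
    by (simp add: H wedge_alt_assoc tc)
  have a2: "wedge_alt H (wedge_alt (lift (re_form \<psi> i x)) tau) = (\<lambda>vs. 0)"
  proof -
    have "wedge_alt H (wedge_alt (lift (re_form \<psi> i x)) tau) =
        wedge_alt ?p (wedge_alt (wedge_alt tau (lift (re_form \<psi> i x))) tau)"
      by (simp only: H wedge_alt_assoc)
    also have "\<dots> = (\<lambda>vs. 0)"
      by (simp add: tc wedge_alt_minus_left wedge_alt_assoc)
    finally show ?thesis .
  qed
  \<comment> \<open>The free factor \<open>f\<close> is \<omega> in the first equation and
    \<open>tau\<close> in the second.\<close>
  have a3: "wedge_alt H (wedge_alt ?w (wedge_alt ?w f)) = (\<lambda>vs. 0)" for f
    by (simp add: H wedge_alt_assoc w_comm pww)
  have b1: "wedge_alt H tau = (\<lambda>vs. 0)"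
    by (simp add: H wedge_alt_assoc)
  have b2: "wedge_alt H (lift (im_form \<psi> i x)) = (\<lambda>vs. 0)"
    by (simp add: H wedge_alt_assoc tc wedge_alt_minus_right)
      (simp add: wedge_alt_assoc[symmetric] p_im')
  have lP: "lift (alt_diff P) = (\<lambda>vs. - wedge_alt ?p ?w vs)"
    by (simp add: dP lift_wedge_alt[symmetric]) (simp add: lift_def fun_eq_iff)
  show "ext_d (rho \<omega> \<psi>) (i, a) (x, t) vs + wedge_alt H (rho \<omega> \<psi> (i, a) (x, t)) vs = 0"
    unfolding ext_d_rho[where \<omega> = \<omega> and \<psi> = \<psi> and i = i and x = x, OF W P hom_omega] rho_at fst_conv wedge_alt_add_right wedge_alt_scale_right
    by (simp add: W0 lP a1 a2 a3 wedge_alt_minus_left)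
  show "ext_d (rho_hat \<omega> \<psi>) (i, a) (x, t) vs + wedge_alt H (rho_hat \<omega> \<psi> (i, a) (x, t)) vs = 0"
    unfolding ext_d_rho_hat[where \<omega> = \<omega> and \<psi> = \<psi> and i = i and x = x, OF W Q hom_omega] rho_hat_at fst_conv wedge_alt_add_right wedge_alt_scale_right
    by (simp add: W0 Q0 b1 b2 a3)
qed

end

section \<open>Structures on the manifold\<close>

lemma wedge_alt_1_1:
  assumes "homogeneous 1 f" "homogeneous 1 g"
  shows "wedge_alt f g [v, w] = f [v] * g [w] - f [w] * g [v]"
  by (simp add: wedge_alt_Cons flip_def homogeneousD[OF assms(1)] homogeneousD[OF assms(2)])

lemma Re_wedge_alt: "Re (wedge_alt (\<lambda>us. complex_of_real (f us)) h vs) = wedge_alt f (\<lambda>us. Re (h us)) vs"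
proof -
  have "Re ((- 1) ^ n * complex_of_real r * c) = (- 1) ^ n * r * Re c" for n r c
    by (cases "even n") simp_all
  then show ?thesis by (simp add: wedge_alt_def)
qed

lemma Im_wedge_alt: "Im (wedge_alt (\<lambda>us. complex_of_real (f us)) h vs) = wedge_alt f (\<lambda>us. Im (h us)) vs"
proof -
  have "Im ((- 1) ^ n * complex_of_real r * c) = (- 1) ^ n * r * Im c" for n r c
    by (cases "even n") simp_all
  then show ?thesis by (simp add: wedge_alt_def)
qed

lemma alternating_form_1_linear:
  assumes "alternating_form 1 f"
  shows "linear (\<lambda>v. f [v])"
proof -
  have "linear (\<lambda>v. f ([undefined][0 := v]))"
    using assms unfolding alternating_form_def by (metis One_nat_def length_Cons list.size(3) zero_less_one)
  then show ?thesis by simp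
qed

text \<open>Six covectors with trivial common kernel define an injective, hence surjective,
  endomorphism of the 6-dimensional space; the preimages of the standard basis form the dual
  basis.\<close>

lemma dual_basis:
  fixes e :: "nat \<Rightarrow> real^6 \<Rightarrow> real"
  assumes lin: "\<And>k. k \<in> {1..6} \<Longrightarrow> linear (e k)"
    and inj: "\<And>v. (\<And>k. k \<in> {1..6} \<Longrightarrow> e k v = 0) \<Longrightarrow> v = 0"
  obtains b where "\<And>k l. k \<in> {1..6} \<Longrightarrow> l \<in> {1..6} \<Longrightarrow> e k (b l) = (if k = l then 1 else 0)"
    and "\<And>v. v = (\<Sum>k = 1..6. e k v *\<^sub>R b k)"
proof -
  have "card (UNIV :: 6 set) = card {1..6::nat}"
    by simp
  \<comment> \<open>Coordinates of \<open>real^6\<close> are indexed by the type \<open>6\<close>,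
    coframes by the numbers from 1 to 6; \<open>h\<close> translates between them.\<close>
  then obtain h where h: "bij_betw h (UNIV :: 6 set) {1..6::nat}"
    using finite_same_card_bij[of "UNIV :: 6 set" "{1..6::nat}"] by auto
  then have h_mem: "h n \<in> {1..6}" for n
    by (auto simp: bij_betw_def)
  have h_surj: "\<exists>n. k = h n" if "k \<in> {1..6}" for k
    using h that unfolding bij_betw_def by (metis imageE)
  define L :: "real^6 \<Rightarrow> real^6" where "L v = (\<chi> n. e (h n) v)" for v
  have L_lin: "linear L"
    unfolding linear_iff L_def vec_eq_iff
    by (simp add: linear_add[OF lin[OF h_mem]] linear_scale[OF lin[OF h_mem]])
  have "v = 0" if "L v = 0" for v
  proof (rule inj)
    fix k :: nat assume "k \<in> {1..6}"
    then obtain n where "k = h n" using h_surj by blast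
    then show "e k v = 0"
      using that by (simp add: L_def vec_eq_iff)
  qed
  then have L_inj: "inj L"
    by (simp add: linear_injective_0[OF L_lin])
  then have "surj L"
    by (rule linear_inj_imp_surj[OF L_lin])
  define b where "b l = inv L (\<chi> n. if h n = l then 1 else 0)" for l
  have b: "L (b l) = (\<chi> n. if h n = l then 1 else 0)" for l
    unfolding b_def by (rule surj_f_inv_f[OF \<open>surj L\<close>])
  have dual: "e k (b l) = (if k = l then 1 else 0)" if k: "k \<in> {1..6}" for k l
  proof -
    obtain n where "k = h n" using h_surj[OF k] by blast
    then show ?thesis
      using arg_cong[OF b[of l], of "\<lambda>u. u $ n"] by (simp add: L_def)
  qed
  have "v = (\<Sum>k = 1..6. e k v *\<^sub>R b k)" for v
  proof (rule injD[OF L_inj])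
    have "e (h n) (\<Sum>k = 1..6. e k v *\<^sub>R b k) = e (h n) v" for n
    proof -
      have "e (h n) (\<Sum>k = 1..6. e k v *\<^sub>R b k) = (\<Sum>k = 1..6. e k v * (if h n = k then 1 else 0))"
        by (simp add: linear_sum[OF lin[OF h_mem]] linear_scale[OF lin[OF h_mem]] dual[OF h_mem])
      also have "\<dots> = e (h n) v"
        using h_mem[of n] by (simp add: if_distrib[of "\<lambda>z. _ * z"] cong: if_cong)
      finally show ?thesis .
    qed
    then show "L v = L (\<Sum>k = 1..6. e k v *\<^sub>R b k)"
      by (simp add: L_def)
  qed
  with dual that show ?thesis by blast
qed

context
  fixes N :: "('i, 'a, real^6) manifold"
    and g :: "'i \<Rightarrow> real^6 \<Rightarrow> real^6 \<Rightarrow> real^6 \<Rightarrow> real"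
    and J :: "'i \<Rightarrow> real^6 \<Rightarrow> real^6 \<Rightarrow> real^6"
    and \<omega> :: "('i, real^6, real) form_field"
    and \<psi> :: "('i, real^6, complex) form_field"
  assumes N: "smooth_manifold N"
    and su3: "su3_structure N g J \<omega> \<psi>"
begin

context
  fixes i x
  assumes i: "i \<in> charts N" and x: "x \<in> cran N i"
begin

section \<open>The SU(3)-structure at a point of a chart\<close>

lemma g_props:
  shows "bilinear (g i x)" "g i x v w = g i x w v" "v \<noteq> 0 \<Longrightarrow> g i x v v > 0"
  using su3 i x unfolding su3_structure_def riemannian_metric_def by blast+

lemma J_props:
  shows "linear (J i x)" "J i x (J i x v) = - v" "g i x (J i x v) (J i x w) = g i x v w"
  using su3 i x unfolding su3_structure_def almost_complex_def orthogonal_acs_def by blast+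

lemma omega_eq: "\<omega> i x = (\<lambda>vs. if length vs = 2 then g i x (J i x (vs ! 0)) (vs ! 1) else 0)"
  using su3 i x unfolding su3_structure_def form_eq_def fundamental_form_def by (intro ext) blast

lemma alternating_omega: "alternating_form 2 (\<omega> i x)"
proof -
  have skew: "g i x (J i x v) v = 0" for v
  proof -
    have "g i x (J i x v) v = g i x (J i x (J i x v)) (J i x v)"
      by (rule J_props(3)[symmetric])
    also have "\<dots> = - g i x v (J i x v)"
      by (simp only: J_props(2) bilinear_lneg[OF g_props(1)])
    finally show ?thesis
      using g_props(2)[of v "J i x v"] by simp
  qed
  have lin: "linear (\<lambda>v. \<omega> i x (vs[k := v]))" if "length vs = 2" "k < 2" for vs :: "(real^6) list" and k
  proof -
    obtain a b where vs: "vs = [a, b]"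
      using \<open>length vs = 2\<close> by (auto simp: numeral_2_eq_2 length_Suc_conv)
    have "linear (\<lambda>v. g i x (J i x v) b)"
      using linear_compose[OF J_props(1), of "\<lambda>v. g i x v b"] g_props(1) by (simp add: bilinear_def o_def)
    moreover have "linear (\<lambda>v. g i x (J i x a) v)"
      using g_props(1) by (simp add: bilinear_def)
    moreover have "k = 0 \<or> k = 1"
      using that by auto
    ultimately show ?thesis
      by (auto simp: vs omega_eq)
  qed
  have eq: "\<omega> i x vs = 0" if "length vs = 2" "k < l" "l < 2" "vs ! k = vs ! l" for vs :: "(real^6) list" and k l
  proof -
    have "k = 0" "l = 1" using that by auto
    with that(4) have "vs ! 0 = vs ! 1" by simp
    then show ?thesis using skew[of "vs ! 1"] by (simp add: omega_eq)
  qed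
  show ?thesis
    unfolding alternating_form_def using lin eq by (auto simp: omega_eq)
qed

lemma omega_invariant: "\<omega> i x [J i x v, J i x w] = \<omega> i x [v, w]"
  by (simp add: omega_eq J_props(3))

lemma adapted_coframe_at:
  obtains V e where "open V" "x \<in> V" "V \<subseteq> cran N i" "adapted_coframe g \<omega> \<psi> i V e"
  using su3 i x unfolding su3_structure_def by blast

text \<open>Positivity of the metric makes the common kernel of the coframe trivial, so a dual basis
  exists. The equations for \<open>J\<close> then follow by comparing \<omega>(v, w) = g(Jv, w) with
  the standard expression of \<omega>.\<close>

lemma su3_frame_at:
  obtains e b where "su3_frame e b (J i x)" "\<omega> i x = su3_frame.om e" "\<psi> i x = su3_frame.ps e"
proof -
  obtain V f where V: "open V" "x \<in> V" and f: "adapted_coframe g \<omega> \<psi> i V f"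
    using adapted_coframe_at by metis
  define e where "e k = f k x" for k
  have alt: "alternating_form 1 (e k)" if "k \<in> {1..6}" for k
    using f V that unfolding adapted_coframe_def e_def by blast
  have g_e: "g i x v w = (\<Sum>k=1..6. e k [v] * e k [w])" for v w
    using f V unfolding adapted_coframe_def e_def by blast
  have om: "\<omega> i x vs = wedge_alt (e 1) (e 2) vs + wedge_alt (e 3) (e 4) vs + wedge_alt (e 5) (e 6) vs" for vs
    using f V unfolding adapted_coframe_def e_def by blast
  have ps: "\<psi> i x = wedge_alt (\<lambda>vs. Complex (e 1 vs) (e 2 vs))
      (wedge_alt (\<lambda>vs. Complex (e 3 vs) (e 4 vs)) (\<lambda>vs. Complex (e 5 vs) (e 6 vs)))"
    using f V unfolding adapted_coframe_def e_def by blast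
  have lin: "linear (\<lambda>v. e k [v])" if "k \<in> {1..6}" for k
    by (rule alternating_form_1_linear[OF alt[OF that]])
  have "v = 0" if "\<And>k. k \<in> {1..6} \<Longrightarrow> e k [v] = 0" for v
  proof -
    have "g i x v v = 0"
      unfolding g_e using that by (intro sum.neutral) simp
    then show ?thesis using g_props(3)[of v] by force
  qed
  from dual_basis[of "\<lambda>k v. e k [v]", OF lin this]
  obtain b where dual: "\<And>k l. k \<in> {1..6} \<Longrightarrow> l \<in> {1..6} \<Longrightarrow> e k [b l] = (if k = l then 1 else 0)"
    and expansion: "\<And>v. v = (\<Sum>k = 1..6. e k [v] *\<^sub>R b k)"
    by blast
  have hom: "homogeneous 1 (e k)" if "k \<in> {1..6}" for k
    by (rule alternating_form_homogeneous[OF alt[OF that]])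
  have om_eval: "\<omega> i x [v, w] = e 1 [v] * e 2 [w] - e 1 [w] * e 2 [v] + (e 3 [v] * e 4 [w] - e 3 [w] * e 4 [v])
      + (e 5 [v] * e 6 [w] - e 5 [w] * e 6 [v])" for v w
    unfolding om by (simp add: wedge_alt_1_1 hom del: One_nat_def)
  \<comment> \<open>The coframe is orthonormal, so evaluating it on \<open>J i x v\<close> is the
    same as taking the inner product with the dual vector \<open>b k\<close>.\<close>
  have e_J: "e k [J i x v] = \<omega> i x [v, b k]" if k: "k \<in> {1..6}" for k v
  proof -
    have "\<omega> i x [v, b k] = (\<Sum>l=1..6. e l [J i x v] * e l [b k])"
      by (simp add: omega_eq g_e)
    also have "\<dots> = (\<Sum>l=1..6. e l [J i x v] * (if l = k then 1 else 0))"
      by (intro sum.cong refl) (simp only: dual[OF _ k])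
    also have "\<dots> = e k [J i x v]"
      using k by (simp add: if_distrib[of "\<lambda>z. _ * z"] cong: if_cong)
    finally show ?thesis by simp
  qed
  have frame: "su3_frame e b (J i x)"
    by standard (use hom dual expansion in \<open>simp_all add: e_J om_eval del: One_nat_def\<close>)
  show ?thesis
  proof (rule that[OF frame])
    show "\<omega> i x = su3_frame.om e"
      by (simp add: su3_frame.om_def[OF frame] om fun_eq_iff)
    show "\<psi> i x = su3_frame.ps e"
      by (simp add: su3_frame.ps_def[OF frame] su3_frame.theta_def[OF frame] ps)
  qed
qed

lemma invariant_wedge_psi:
  assumes p: "alternating_form 2 p" and inv: "\<And>v w. p [J i x v, J i x w] = p [v, w]"
  shows "wedge_alt p (re_form \<psi> i x) = (\<lambda>vs. 0)" "wedge_alt p (im_form \<psi> i x) = (\<lambda>vs. 0)"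
proof -
  obtain e b where frame: "su3_frame e b (J i x)" and ps: "\<psi> i x = su3_frame.ps e"
    using su3_frame_at by metis
  have "wedge_alt (\<lambda>vs. complex_of_real (p vs)) (\<psi> i x) = (\<lambda>vs. 0)"
    unfolding ps by (rule su3_frame.invariant_wedge_ps[OF frame p inv J_props(2)])
  then show "wedge_alt p (re_form \<psi> i x) = (\<lambda>vs. 0)" "wedge_alt p (im_form \<psi> i x) = (\<lambda>vs. 0)"
    by (simp_all add: fun_eq_iff re_form_def im_form_def Re_wedge_alt[symmetric] Im_wedge_alt[symmetric])
qed

lemma wedge_im_psi_imp_invariant:
  assumes p: "alternating_form 2 p" and zero: "wedge_alt p (im_form \<psi> i x) = (\<lambda>vs. 0)"
  shows "p [J i x v, J i x w] = p [v, w]"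
proof -
  obtain e b where frame: "su3_frame e b (J i x)" and ps: "\<psi> i x = su3_frame.ps e"
    using su3_frame_at by metis
  show ?thesis
    by (rule su3_frame.wedge_Im_ps_imp_invariant[OF frame p])
      (use zero in \<open>simp add: im_form_def fun_eq_iff ps\<close>)
qed

lemma wedge_omega_inject:
  assumes p: "alternating_form 2 p" and q: "alternating_form 2 q"
    and eq: "wedge_alt p (\<omega> i x) = wedge_alt q (\<omega> i x)"
  shows "p = q"
proof
  fix vs
  obtain e b where frame: "su3_frame e b (J i x)" and om: "\<omega> i x = su3_frame.om e"
    using su3_frame_at by metis
  have "alternating_form 2 (\<lambda>vs. p vs - q vs)"
    using p q unfolding alternating_form_def by (simp add: linear_compose_sub)
  moreover have "wedge_alt (\<lambda>vs. p vs - q vs) (su3_frame.om e) us = 0" for us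
    using eq by (simp add: wedge_alt_diff_left om[symmetric])
  ultimately have "p vs - q vs = 0"
    by (rule su3_frame.wedge_om_inject[OF frame])
  then show "p vs = q vs" by simp
qed

lemma alternating_psi: "alternating_form 3 (\<psi> i x)"
  using su3 i x unfolding su3_structure_def diff_form_def by blast

lemma homogeneous_forms:
  "homogeneous 2 (\<omega> i x)" "homogeneous 3 (re_form \<psi> i x)" "homogeneous 3 (im_form \<psi> i x)"
  using alternating_form_homogeneous[OF alternating_omega] alternating_form_homogeneous[OF alternating_psi]
  by (simp_all add: homogeneous_def re_form_def im_form_def)

text \<open>The form \<omega> is itself an invariant 2-form, so \<open>invariant_wedge_psi\<close>
  applies to it.\<close>

lemma re_wedge_omega: "wedge_alt (re_form \<psi> i x) (\<omega> i x) = (\<lambda>vs. 0)"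
  using invariant_wedge_psi(1)[OF alternating_omega omega_invariant]
    wedge_alt_commute_even[OF homogeneous_forms(1), of "re_form \<psi> i x"] by simp

end

text \<open>Differentiability of \<omega> comes from the product rule for its expression in a smooth
  adapted coframe, that of \<psi> from its smoothness as a differential form.\<close>

lemma form_derivatives:
  assumes i: "i \<in> charts N" and x: "x \<in> cran N i"
  obtains W P Q where "has_form_derivative (\<omega> i) W x" "has_form_derivative (re_form \<psi> i) P x"
    "has_form_derivative (im_form \<psi> i) Q x"
    "homogeneous 3 (alt_diff W)" "homogeneous 4 (alt_diff P)" "homogeneous 4 (alt_diff Q)"
proof -
  note open_cran = smooth_manifold_open_cran[OF N i]
  obtain V e where V: "open V" "x \<in> V" and e: "adapted_coframe g \<omega> \<psi> i V e"
    using adapted_coframe_at[OF i x] by metis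
  have "smooth_on (\<lambda>y. e k y vs) V" if "k \<in> {1..6}" for k vs
    using e that unfolding adapted_coframe_def by blast
  then have D: "has_form_derivative (e k) (\<lambda>v vs. frechet_derivative (\<lambda>y. e k y vs) (at x) v) x"
    if "k \<in> {1..6}" for k
    using that V by (intro has_form_derivativeI smooth_on_imp_differentiable)
  have om: "\<omega> i y vs = wedge_alt (e 1 y) (e 2 y) vs + wedge_alt (e 3 y) (e 4 y) vs + wedge_alt (e 5 y) (e 6 y) vs"
    if "y \<in> V" for y vs
    using e that unfolding adapted_coframe_def by blast
  obtain W where W': "has_form_derivative (\<lambda>y vs. wedge_alt (e 1 y) (e 2 y) vs
      + wedge_alt (e 3 y) (e 4 y) vs + wedge_alt (e 5 y) (e 6 y) vs) W x"
    using has_form_derivative_add[OF has_form_derivative_add[OF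
          has_form_derivative_wedge_alt[OF D[of 1] D[of 2]] has_form_derivative_wedge_alt[OF D[of 3] D[of 4]]]
        has_form_derivative_wedge_alt[OF D[of 5] D[of 6]]] by auto
  have W: "has_form_derivative (\<omega> i) W x"
    unfolding has_form_derivative_def
  proof
    fix vs
    show "((\<lambda>y. \<omega> i y vs) has_derivative (\<lambda>v. W v vs)) (at x)"
      by (rule has_derivative_transform_within_open[OF W'[unfolded has_form_derivative_def, rule_format] V])
        (simp add: om)
  qed
  define D\<psi> where "D\<psi> v vs = frechet_derivative (\<lambda>y. \<psi> i y vs) (at x) v" for v vs
  have "smooth_on (\<lambda>y. \<psi> i y vs) (cran N i)" for vs
    using su3 i unfolding su3_structure_def diff_form_def by blast
  then have "(\<lambda>y. \<psi> i y vs) differentiable (at x)" for vs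
    by (rule smooth_on_imp_differentiable[OF _ x])
  then have D\<psi>: "((\<lambda>y. \<psi> i y vs) has_derivative (\<lambda>v. D\<psi> v vs)) (at x)" for vs
    by (simp add: D\<psi>_def frechet_derivative_works[symmetric])
  have P: "has_form_derivative (re_form \<psi> i) (\<lambda>v vs. Re (D\<psi> v vs)) x"
    unfolding has_form_derivative_def re_form_def
    by (intro allI bounded_linear.has_derivative[OF bounded_linear_Re] D\<psi>)
  have Q: "has_form_derivative (im_form \<psi> i) (\<lambda>v vs. Im (D\<psi> v vs)) x"
    unfolding has_form_derivative_def im_form_def
    by (intro allI bounded_linear.has_derivative[OF bounded_linear_Im] D\<psi>)
  note hd = has_form_derivative_homogeneous[OF _ open_cran x]
  have "homogeneous 3 (alt_diff W)"
    using homogeneous_alt_diff[OF hd[OF W homogeneous_forms(1)[OF i]]] by simp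
  moreover have "homogeneous 4 (alt_diff (\<lambda>v vs. Re (D\<psi> v vs)))"
    using homogeneous_alt_diff[OF hd[OF P homogeneous_forms(2)[OF i]]] by simp
  moreover have "homogeneous 4 (alt_diff (\<lambda>v vs. Im (D\<psi> v vs)))"
    using homogeneous_alt_diff[OF hd[OF Q homogeneous_forms(3)[OF i]]] by simp
  ultimately show ?thesis
    using that[OF W P Q] by blast
qed

text \<open>The product of \<psi>_+ and \<omega> vanishes on the whole chart. Differentiating it
  with d\<omega> = 0 leaves the product of d\<psi>_+ and \<omega>, which is minus the claimed
  expression.\<close>

lemma primitive:
  assumes i: "i \<in> charts N" and x: "x \<in> cran N i"
    and W: "has_form_derivative (\<omega> i) W x" "alt_diff W = (\<lambda>vs. 0)"
    and P: "has_form_derivative (re_form \<psi> i) P x" "alt_diff P = (\<lambda>vs. - wedge_alt p (\<omega> i x) vs)"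
  shows "wedge_alt p (wedge_alt (\<omega> i x) (\<omega> i x)) = (\<lambda>vs. 0)"
proof -
  define D where "D v vs = wedge_alt (P v) (\<omega> i x) vs + wedge_alt (re_form \<psi> i x) (W v) vs" for v vs
  have D: "has_form_derivative (\<lambda>y. wedge_alt (re_form \<psi> i y) (\<omega> i y)) D x"
    unfolding D_def by (rule has_form_derivative_wedge_alt[OF P(1) W(1)])
  \<comment> \<open>The zero field is homogeneous of every degree. Applying this to degrees 0 and 1
    covers lists of all lengths, so \<open>D\<close> vanishes.\<close>
  have "homogeneous k (D v)" for k v
    by (rule has_form_derivative_homogeneous[OF D smooth_manifold_open_cran[OF N i] x])
      (simp add: re_wedge_omega[OF i] homogeneous_def)
  from homogeneousD[OF this[of 0]] homogeneousD[OF this[of 1]] have "D v vs = 0" for v vs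
    by (cases vs) simp_all
  then have "D = (\<lambda>v vs. 0)"
    by (simp add: fun_eq_iff)
  then have "alt_diff D = (\<lambda>vs. 0)"
    by simp
  then have "wedge_alt (alt_diff P) (\<omega> i x) = (\<lambda>vs. 0)"
    unfolding D_def alt_diff_add alt_diff_wedge_left alt_diff_wedge_right by (simp add: W(2))
  then show ?thesis
    by (simp add: P(2) wedge_alt_minus_left wedge_alt_assoc fun_eq_iff)
qed

end

section \<open>From points to the product with the circle\<close>

lemma form_eq_prod_circle:
  "form_eq (prod_manifold M circle) F G \<longleftrightarrow>
    (\<forall>i\<in>charts M. \<forall>x\<in>cran M i. \<forall>a. \<forall>t\<in>{a<..<a + 2 * pi}. F (i, a) (x, t) = G (i, a) (x, t))"
proof -
  have "charts (prod_manifold M circle) = charts M \<times> UNIV"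
    by (simp add: prod_manifold_def circle_def)
  then show ?thesis
    unfolding form_eq_def by (auto simp: cran_prod_manifold cran_circle fun_eq_iff)
qed

lemma wedge_dt_at: "(pull_fst F \<^bold>\<and> pull_snd dt) (i, a) (x, t) = wedge_alt (lift (F i x)) tau"
  by (simp add: wedge_def pull_fst_eq_lift pull_snd_dt)

text \<open>The contraction is taken at t = pi, inside the range of the circle chart 0. With this
  chart fixed, transition maps of the product preserve both t and the unit vector
  \<open>(0, 1)\<close>, so the contraction transforms like a form on \<open>M\<close>.\<close>

lemma diff_form_contract_t:
  fixes M :: "('i, 'a, 'e::euclidean_space) manifold"
  assumes M: "smooth_manifold M" and H: "diff_form (prod_manifold M circle) 3 H"
  shows "diff_form M 2 (\<lambda>i x. contract_t (H (i, 0) (x, pi)))"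
  unfolding diff_form_def
proof (intro conjI ballI allI)
  have charts: "(i, 0) \<in> charts (prod_manifold M circle)" if "i \<in> charts M" for i
    using that by (simp add: prod_manifold_def circle_def)
  have pi: "pi \<in> cran circle 0" "open (cran circle 0)"
    by (simp_all add: cran_circle)
  show "alternating_form 2 (contract_t (H (i, 0) (x, pi)))" if "i \<in> charts M" "x \<in> cran M i" for i x
  proof (rule alternating_form_contract_t)
    have "(x, pi) \<in> cran (prod_manifold M circle) (i, 0)"
      using that(2) pi(1) by (simp add: cran_prod_manifold)
    then show "alternating_form 3 (H (i, 0) (x, pi))"
      using H charts[OF that(1)] unfolding diff_form_def by blast
  qed
  show "smooth_on (\<lambda>x. contract_t (H (i, 0) (x, pi)) vs) (cran M i)" if i: "i \<in> charts M" for i vs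
  proof (cases "length vs = 2")
    case True
    have "smooth_on (\<lambda>z. H (i, 0) z (map emb vs @ [(0, 1)])) (cran M i \<times> cran circle 0)"
      using H charts[OF i] unfolding diff_form_def cran_prod_manifold[symmetric] by blast
    from smooth_on_slice[OF this smooth_manifold_open_cran[OF M i] pi(1)] True show ?thesis
      by (simp add: contract_t_def)
  next
    case False
    then show ?thesis by (simp add: contract_t_def smooth_on_const)
  qed
  show "contract_t (H (i, 0) (x, pi)) vs =
      contract_t (H (j, 0) (trans_map M i j x, pi)) (map (trans_deriv M i j x) vs)"
    if i: "i \<in> charts M" and j: "j \<in> charts M" and x: "x \<in> overlap M i j" for i j x vs
  proof (cases "length vs = 2")
    case True
    have xi: "x \<in> cran M i"
      using x by (auto simp: overlap_def cran_def)
    have "(x, pi) \<in> overlap (prod_manifold M circle) (i, 0) (j, 0)"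
      using x pi(1) by (simp add: overlap_prod_manifold overlap_self)
    then have "H (i, 0) (x, pi) us = H (j, 0) (trans_map (prod_manifold M circle) (i, 0) (j, 0) (x, pi))
        (map (trans_deriv (prod_manifold M circle) (i, 0) (j, 0) (x, pi)) us)" for us
      using H charts[OF i] charts[OF j] unfolding diff_form_def by blast
    moreover have "trans_map (prod_manifold M circle) (i, 0) (j, 0) (x, pi) = (trans_map M i j x, pi)"
      by (rule trans_map_prod_manifold_self[OF smooth_manifold_inj_on[OF M i] xi pi(1)])
    moreover have deriv: "trans_deriv (prod_manifold M circle) (i, 0) (j, 0) (x, pi) (v, s) = (trans_deriv M i j x v, s)"
      for v s by (rule trans_deriv_prod_manifold_self[OF M i j x pi])
    \<comment> \<open>Ensures that the derivative of the product transition sends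
      \<open>(0, 1)\<close> to itself.\<close>
    moreover have "trans_deriv M i j x 0 = 0"
    proof -
      have "smooth_on (trans_map M i j) (overlap M i j)"
        using M i j by (simp add: smooth_manifold_def)
      then have "linear (trans_deriv M i j x)"
        unfolding trans_deriv_def by (intro linear_frechet_derivative smooth_on_imp_differentiable[OF _ x])
      then show ?thesis by (rule linear_0)
    qed
    ultimately show ?thesis
      using True by (simp add: contract_t_def emb_def o_def)
  next
    case False
    then show ?thesis by (simp add: contract_t_def)
  qed
qed

theorem theorem5p1:
  fixes N :: "('i, 'a, real^6) manifold"
    and g :: "'i \<Rightarrow> real^6 \<Rightarrow> real^6 \<Rightarrow> real^6 \<Rightarrow> real"
    and J :: "'i \<Rightarrow> real^6 \<Rightarrow> real^6 \<Rightarrow> real^6"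
    and \<omega> :: "('i, real^6, real) form_field"
    and \<psi> :: "('i, real^6, complex) form_field"
    and H :: "('i \<times> real, (real^6) \<times> real, real) form_field"
  assumes "smooth_manifold N"
    and "su3_structure N g J \<omega> \<psi>"
    and "diff_form (prod_manifold N circle) 3 H"
  shows "strongly_integrable (prod_manifold N circle) H (rho \<omega> \<psi>) (rho_hat \<omega> \<psi>) \<longleftrightarrow>
    (\<exists>\<pi>\<^sub>2. W2_plus N J \<omega> \<psi> \<pi>\<^sub>2 \<and>
      form_eq (prod_manifold N circle) H (pull_fst \<pi>\<^sub>2 \<^bold>\<and> pull_snd dt))"
proof
  note N = assms(1) and su3 = assms(2) and H = assms(3)
  have alternating_H: "alternating_form 3 (H (i, a) (x, t))"
    if "i \<in> charts N" "x \<in> cran N i" "t \<in> {a<..<a + 2 * pi}" for i a x t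
  proof -
    have "(i, a) \<in> charts (prod_manifold N circle)" "(x, t) \<in> cran (prod_manifold N circle) (i, a)"
      using that by (simp_all add: cran_prod_manifold cran_circle) (simp add: prod_manifold_def circle_def)
    then show ?thesis
      using H unfolding diff_form_def by blast
  qed
  {
    assume "strongly_integrable (prod_manifold N circle) H (rho \<omega> \<psi>) (rho_hat \<omega> \<psi>)"
    then have int:
      "ext_d (rho \<omega> \<psi>) (i, a) (x, t) vs + wedge_alt (H (i, a) (x, t)) (rho \<omega> \<psi> (i, a) (x, t)) vs = 0"
      "ext_d (rho_hat \<omega> \<psi>) (i, a) (x, t) vs + wedge_alt (H (i, a) (x, t)) (rho_hat \<omega> \<psi> (i, a) (x, t)) vs = 0"
      if "i \<in> charts N" "x \<in> cran N i" "t \<in> {a<..<a + 2 * pi}" for i a x t vs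
      using that unfolding strongly_integrable_def form_eq_prod_circle
      by (simp_all add: form_plus_def zero_form_def wedge_def fun_eq_iff)
    \<comment> \<open>The candidate for the torsion form freezes the chart 0 and t = pi; that the
      contraction is the same in all circle charts and for all t is proved below.\<close>
    define \<pi> where "\<pi> i x = contract_t (H (i, 0) (x, pi))" for i x
    have torsion:
      "ext_d \<omega> i x = (\<lambda>vs. 0)" "ext_d (im_form \<psi>) i x = (\<lambda>vs. 0)"
      "ext_d (re_form \<psi>) i x = (\<lambda>vs. - wedge_alt (contract_t (H (i, a) (x, t))) (\<omega> i x) vs)"
      "wedge_alt (contract_t (H (i, a) (x, t))) (im_form \<psi> i x) = (\<lambda>vs. 0)"
      "H (i, a) (x, t) = wedge_alt (lift (contract_t (H (i, a) (x, t)))) tau"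
      "wedge_alt (contract_t (H (i, a) (x, t))) (wedge_alt (\<omega> i x) (\<omega> i x)) = (\<lambda>vs. 0)"
      if i: "i \<in> charts N" and x: "x \<in> cran N i" and t: "t \<in> {a<..<a + 2 * pi}" for i a x t
    proof -
      obtain W P Q where W: "has_form_derivative (\<omega> i) W x" and P: "has_form_derivative (re_form \<psi> i) P x"
        and Q: "has_form_derivative (im_form \<psi> i) Q x"
        and hom: "homogeneous 3 (alt_diff W)" "homogeneous 4 (alt_diff P)" "homogeneous 4 (alt_diff Q)"
        by (rule form_derivatives[OF N su3 i x])
      note pointwise = pointwise_integrable_imp[where \<omega> = \<omega> and \<psi> = \<psi> and i = i and x = x,
          OF W P Q hom homogeneous_forms[OF N su3 i x] alternating_H[OF i x t] int[OF i x t]]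
      show "ext_d \<omega> i x = (\<lambda>vs. 0)"
        using pointwise(1) by (simp add: ext_d_eq_alt_diff[where F = \<omega>, OF W])
      show "ext_d (im_form \<psi>) i x = (\<lambda>vs. 0)"
        using pointwise(2) by (simp add: ext_d_eq_alt_diff[where F = "im_form \<psi>", OF Q])
      show "ext_d (re_form \<psi>) i x = (\<lambda>vs. - wedge_alt (contract_t (H (i, a) (x, t))) (\<omega> i x) vs)"
        using pointwise(3) by (simp add: ext_d_eq_alt_diff[where F = "re_form \<psi>", OF P])
      show "wedge_alt (contract_t (H (i, a) (x, t))) (im_form \<psi> i x) = (\<lambda>vs. 0)"
        by (rule pointwise(4))
      show "H (i, a) (x, t) = wedge_alt (lift (contract_t (H (i, a) (x, t)))) tau"
        by (rule pointwise(5))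
      show "wedge_alt (contract_t (H (i, a) (x, t))) (wedge_alt (\<omega> i x) (\<omega> i x)) = (\<lambda>vs. 0)"
        by (rule primitive[OF N su3 i x W pointwise(1) P pointwise(3)])
    qed
    have pi: "pi \<in> {0<..<0 + 2 * pi}"
      by simp
    have alternating_\<pi>: "alternating_form 2 (\<pi> i x)" if "i \<in> charts N" "x \<in> cran N i" for i x
      unfolding \<pi>_def by (rule alternating_form_contract_t[OF alternating_H[OF that pi]])
    have "H (i, a) (x, t) = wedge_alt (lift (\<pi> i x)) tau"
      if i: "i \<in> charts N" and x: "x \<in> cran N i" and t: "t \<in> {a<..<a + 2 * pi}" for i a x t
    proof -
      \<comment> \<open>Both sides equal minus d\<psi>_+ at \<open>x\<close>, which does not involve
        t.\<close>
      have "wedge_alt (contract_t (H (i, a) (x, t))) (\<omega> i x) = wedge_alt (\<pi> i x) (\<omega> i x)"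
        using torsion(3)[OF i x t] torsion(3)[OF i x pi] by (simp add: \<pi>_def fun_eq_iff)
      then have "contract_t (H (i, a) (x, t)) = \<pi> i x"
        by (rule wedge_omega_inject[OF N su3 i x
              alternating_form_contract_t[OF alternating_H[OF i x t]] alternating_\<pi>[OF i x]])
      with torsion(5)[OF i x t] show ?thesis by simp
    qed
    then have "form_eq (prod_manifold N circle) H (pull_fst \<pi> \<^bold>\<and> pull_snd dt)"
      unfolding form_eq_prod_circle by (simp add: wedge_dt_at)
    moreover have "W2_plus N J \<omega> \<psi> \<pi>"
      unfolding W2_plus_def
    proof (intro conjI ballI allI)
      show "diff_form N 2 \<pi>"
        using diff_form_contract_t[OF N H] by (simp add: \<pi>_def[abs_def])
      show "\<pi> i x [J i x v, J i x w] = \<pi> i x [v, w]" if "i \<in> charts N" "x \<in> cran N i" for i x v w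
        by (rule wedge_im_psi_imp_invariant[OF N su3 that alternating_\<pi>[OF that]])
          (unfold \<pi>_def, rule torsion(4)[OF that pi])
      show "form_eq N (\<pi> \<^bold>\<and> \<omega> \<^bold>\<and> \<omega>) zero_form" "form_eq N (ext_d \<omega>) zero_form"
        "form_eq N (ext_d (im_form \<psi>)) zero_form"
        using torsion[OF _ _ pi] by (simp_all add: form_eq_def wedge_def zero_form_def \<pi>_def)
      show "form_eq N (ext_d (re_form \<psi>)) (- 1 \<^bold>* (\<pi> \<^bold>\<and> \<omega>))"
        using torsion(3)[OF _ _ pi] by (simp add: form_eq_def wedge_def form_scale_def \<pi>_def)
    qed
    ultimately show "\<exists>\<pi>\<^sub>2. W2_plus N J \<omega> \<psi> \<pi>\<^sub>2 \<and>
        form_eq (prod_manifold N circle) H (pull_fst \<pi>\<^sub>2 \<^bold>\<and> pull_snd dt)"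
      by blast
  }
  {
    assume "\<exists>\<pi>\<^sub>2. W2_plus N J \<omega> \<psi> \<pi>\<^sub>2 \<and>
        form_eq (prod_manifold N circle) H (pull_fst \<pi>\<^sub>2 \<^bold>\<and> pull_snd dt)"
    then obtain \<pi> where W2: "W2_plus N J \<omega> \<psi> \<pi>"
      and H_eq: "form_eq (prod_manifold N circle) H (pull_fst \<pi> \<^bold>\<and> pull_snd dt)"
      by blast
    have "ext_d (rho \<omega> \<psi>) (i, a) (x, t) vs + wedge_alt (H (i, a) (x, t)) (rho \<omega> \<psi> (i, a) (x, t)) vs = 0 \<and>
      ext_d (rho_hat \<omega> \<psi>) (i, a) (x, t) vs + wedge_alt (H (i, a) (x, t)) (rho_hat \<omega> \<psi> (i, a) (x, t)) vs = 0"
      if i: "i \<in> charts N" and x: "x \<in> cran N i" and t: "t \<in> {a<..<a + 2 * pi}" for i a x t vs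
    proof -
      obtain W P Q where W: "has_form_derivative (\<omega> i) W x" and P: "has_form_derivative (re_form \<psi> i) P x"
        and Q: "has_form_derivative (im_form \<psi> i) Q x"
        and hom: "homogeneous 3 (alt_diff W)" "homogeneous 4 (alt_diff P)" "homogeneous 4 (alt_diff Q)"
        by (rule form_derivatives[OF N su3 i x])
      have alt: "alternating_form 2 (\<pi> i x)"
        using W2 i x unfolding W2_plus_def diff_form_def by blast
      have inv: "\<pi> i x [J i x v, J i x w] = \<pi> i x [v, w]" for v w
        using W2 i x unfolding W2_plus_def by blast
      have zero: "(\<pi> \<^bold>\<and> \<omega> \<^bold>\<and> \<omega>) i x vs = 0" "ext_d \<omega> i x vs = 0" "ext_d (im_form \<psi>) i x vs = 0"
        "ext_d (re_form \<psi>) i x vs = (- 1 \<^bold>* (\<pi> \<^bold>\<and> \<omega>)) i x vs" for vs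
        using W2 i x unfolding W2_plus_def form_eq_def zero_form_def by blast+
      have "H (i, a) (x, t) = wedge_alt (lift (\<pi> i x)) tau"
        using H_eq i x t unfolding form_eq_prod_circle by (simp add: wedge_dt_at)
      moreover have "alt_diff W = (\<lambda>vs. 0)"
        using zero(2) by (simp add: ext_d_eq_alt_diff[where F = \<omega>, OF W] fun_eq_iff)
      moreover have "alt_diff Q = (\<lambda>vs. 0)"
        using zero(3) by (simp add: ext_d_eq_alt_diff[where F = "im_form \<psi>", OF Q] fun_eq_iff)
      moreover have "alt_diff P = (\<lambda>vs. - wedge_alt (\<pi> i x) (\<omega> i x) vs)"
        using zero(4) by (simp add: ext_d_eq_alt_diff[where F = "re_form \<psi>", OF P] fun_eq_iff
            form_scale_def wedge_def)
      moreover have "wedge_alt (\<pi> i x) (wedge_alt (\<omega> i x) (\<omega> i x)) = (\<lambda>vs. 0)"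
        using zero(1) by (simp add: wedge_def fun_eq_iff)
      ultimately show ?thesis
        \<comment> \<open>Invariance of \<pi> enters here: it makes the product of \<pi> and
          \<psi>_- vanish.\<close>
        using pointwise_integrable[where \<omega> = \<omega> and \<psi> = \<psi> and i = i and x = x and p = "\<pi> i x",
            OF W P Q hom homogeneous_forms[OF N su3 i x] _ alternating_form_homogeneous[OF alt] _ _ _
            invariant_wedge_psi(2)[OF N su3 i x alt inv]]
        by simp
    qed
    then show "strongly_integrable (prod_manifold N circle) H (rho \<omega> \<psi>) (rho_hat \<omega> \<psi>)"
      unfolding strongly_integrable_def form_eq_prod_circle
      by (simp add: form_plus_def zero_form_def wedge_def fun_eq_iff)
  }
qed

end
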